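(* Let $a\in\mathbb{R}^k$, $A\in\mathbb{R}^{k\times d}$ with $P=\{x\in\mathbb{R}^d : a-Ax\ge 0\}$ a polytope with nonempty interior, and let $B=[b^{(1)},\ldots,b^{(l)}]\in\mathbb{R}^{d\times l}$ with $Q=\operatorname{conv}(b^{(1)},\ldots,b^{(l)})$ containing the origin in its interior. Let $Q^\circ=\{z : \mathbb{1}_l-B^Tz\ge 0\}$ and $\mu^*=\sup\{x^Tz : (x,z)\in P\times Q^\circ\}$. Assume that every optimal solution of this supremum problem is a pair $(x,z)$ with $x$ a vertex of $P$ and $z$ a vertex of $Q^\circ$ (equivalently, the problem has only finitely many optimal solutions). Then $\mu^*-x^Tz\in\mathrm{QM}(A,B)$; consequently there is an integer $t\ge 2$ with $\mu(t)=\mu^*$, so the hierarchy decides whether $P\subseteq Q$ in finitely many steps.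
   Context: $x,z$ are variables in $\mathbb{R}^d$, $\mathbb{1}_l$ is the all-ones vector. Let $g_1,\ldots,g_{k+l}\in\mathbb{R}[x,z]$ be the affine polynomials $(a-Ax)_i$, $i=1,\ldots,k$, and $(\mathbb{1}_l-B^Tz)_j$, $j=1,\ldots,l$, and $\Sigma[x,z]$ the set of sums of squares of polynomials. $\mathrm{QM}(A,B)=\{\sigma_0+\sum_{i}\sigma_ig_i : \sigma_i\in\Sigma[x,z]\}$ is the quadratic module; its truncation $\mathrm{QM}_t(A,B)$ additionally requires $\deg\sigma_0\le 2t$ and $\deg(\sigma_ig_i)\le 2t$, and $\mu(t)=\inf\{\mu\in\mathbb{R}:\mu-x^Tz\in\mathrm{QM}_t(A,B)\}$. *)

theory Defs
  imports "HOL-Analysis.Analysis" "HOL-Library.Poly_Mapping"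
begin

text \<open>
  Real polynomials with variables indexed by \<open>'v\<close>: a monomial is a finitely supported
  exponent map, a polynomial a finitely supported map from monomials to coefficients.
  Multiplication of \<open>poly_mapping\<close> is convolution over addition of monomials, which is
  multiplication of polynomials.
\<close>

type_synonym 'v rpoly = "('v \<Rightarrow>\<^sub>0 nat) \<Rightarrow>\<^sub>0 real"

definition PVar :: "'v \<Rightarrow> 'v rpoly" where
  "PVar v = Poly_Mapping.single (Poly_Mapping.single v 1) 1"

definition PConst :: "real \<Rightarrow> 'v rpoly" where
  "PConst c = Poly_Mapping.single 0 c"

definition monom_degree :: "('v \<Rightarrow>\<^sub>0 nat) \<Rightarrow> nat" where
  "monom_degree m = (\<Sum>v\<in>Poly_Mapping.keys m. Poly_Mapping.lookup m v)"

text \<open>The total degree; the zero polynomial gets degree \<open>0\<close>, which satisfies every bound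
  \<open>\<le> 2 * t\<close> just as the convention \<open>-\<infinity>\<close> does.\<close>

definition total_degree :: "'v rpoly \<Rightarrow> nat" where
  "total_degree p = Max (insert 0 (monom_degree ` Poly_Mapping.keys p))"

definition sos :: "'v rpoly set" where
  "sos = {p. \<exists>(n::nat) q. p = (\<Sum>i<n. (q i)\<^sup>2)}"

definition quadratic_module :: "('i::finite \<Rightarrow> 'v rpoly) \<Rightarrow> 'v rpoly set" where
  "quadratic_module g =
     {\<sigma>0 + (\<Sum>i\<in>UNIV. \<sigma> i * g i) | \<sigma>0 \<sigma>. \<sigma>0 \<in> sos \<and> (\<forall>i. \<sigma> i \<in> sos)}"

definition truncated_quadratic_module ::
    "nat \<Rightarrow> ('i::finite \<Rightarrow> 'v rpoly) \<Rightarrow> 'v rpoly set" where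
  "truncated_quadratic_module t g =
     {\<sigma>0 + (\<Sum>i\<in>UNIV. \<sigma> i * g i) | \<sigma>0 \<sigma>.
        \<sigma>0 \<in> sos \<and> total_degree \<sigma>0 \<le> 2 * t \<and>
        (\<forall>i. \<sigma> i \<in> sos \<and> total_degree (\<sigma> i * g i) \<le> 2 * t)}"

text \<open>The variables of \<open>\<real>[x,z]\<close> are indexed by \<open>'d + 'd\<close>: \<open>Inl i\<close> is \<open>x\<^sub>i\<close> and \<open>Inr i\<close> is \<open>z\<^sub>i\<close>.\<close>

abbreviation PX :: "'d \<Rightarrow> ('d + 'd) rpoly" where
  "PX i \<equiv> PVar (Inl i)"

abbreviation PZ :: "'d \<Rightarrow> ('d + 'd) rpoly" where
  "PZ i \<equiv> PVar (Inr i)"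

text \<open>The polynomial \<open>x\<^sup>T z\<close>.\<close>

definition xTz :: "('d::finite + 'd) rpoly" where
  "xTz = (\<Sum>i\<in>UNIV. PX i * PZ i)"

text \<open>The polynomials \<open>(a - A x)\<^sub>i\<close> at index \<open>Inl i\<close> and \<open>(1 - B\<^sup>T z)\<^sub>j\<close> at index \<open>Inr j\<close>.\<close>

definition constraint ::
    "real^'k \<Rightarrow> real^'d^'k \<Rightarrow> real^'l^'d \<Rightarrow> 'k + 'l \<Rightarrow> ('d::finite + 'd) rpoly" where
  "constraint a A B c = (case c of
      Inl i \<Rightarrow> PConst (a $ i) - (\<Sum>j\<in>UNIV. PConst (A $ i $ j) * PX j)
    | Inr j \<Rightarrow> PConst 1 - (\<Sum>i\<in>UNIV. PConst (B $ i $ j) * PZ i))"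

definition QM ::
    "real^'k \<Rightarrow> real^'d^'k \<Rightarrow> real^'l^'d \<Rightarrow> ('d::finite + 'd) rpoly set" where
  "QM a A B = quadratic_module (constraint a A B)"

definition QM_trunc ::
    "nat \<Rightarrow> real^'k \<Rightarrow> real^'d^'k \<Rightarrow> real^'l^'d \<Rightarrow> ('d::finite + 'd) rpoly set" where
  "QM_trunc t a A B = truncated_quadratic_module t (constraint a A B)"

text \<open>Extended reals, so that the infimum over the empty set is \<open>\<infinity>\<close>.\<close>

definition mu_level :: "real^'k \<Rightarrow> real^'d^'k \<Rightarrow> real^'l^'d \<Rightarrow> nat \<Rightarrow> ereal" where
  "mu_level a A B t = Inf (ereal ` {\<mu>. PConst \<mu> - xTz \<in> QM_trunc t a A B})"

text \<open>Below, \<open>0 \<le> v\<close> on vectors is the componentwise order and \<open>1\<close> is the all-ones vector.\<close>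

definition H_polyhedron :: "real^'k \<Rightarrow> real^'d^'k \<Rightarrow> (real^'d) set" where
  "H_polyhedron a A = {x. 0 \<le> a - A *v x}"

definition V_polytope :: "real^'l^'d \<Rightarrow> (real^'d) set" where
  "V_polytope B = convex hull (columns B)"

definition polar_polyhedron :: "real^'l^'d \<Rightarrow> (real^'d) set" where
  "polar_polyhedron B = {z. 0 \<le> 1 - transpose B *v z}"

text \<open>A real supremum: the feasible set is nonempty and compact whenever
  \<open>H_polyhedron a A\<close> is a nonempty polytope and \<open>0\<close> is interior to \<open>V_polytope B\<close>.\<close>

definition mu_star :: "real^'k \<Rightarrow> real^'d^'k \<Rightarrow> real^'l^'d \<Rightarrow> real" where
  "mu_star a A B = (SUP (x, z) \<in> H_polyhedron a A \<times> polar_polyhedron B. x \<bullet> z)"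

definition optimal_solutions ::
    "real^'k \<Rightarrow> real^'d^'k \<Rightarrow> real^'l^'d \<Rightarrow> ((real^'d) \<times> (real^'d)) set" where
  "optimal_solutions a A B =
     {(x, z) \<in> H_polyhedron a A \<times> polar_polyhedron B. x \<bullet> z = mu_star a A B}"

definition optima_are_vertex_pairs :: "real^'k \<Rightarrow> real^'d^'k \<Rightarrow> real^'l^'d \<Rightarrow> bool" where
  "optima_are_vertex_pairs a A B \<longleftrightarrow>
     (\<forall>(x, z) \<in> optimal_solutions a A B.
        x extreme_point_of H_polyhedron a A \<and> z extreme_point_of polar_polyhedron B)"

end

theory Submission
  imports Defs
begin

text \<open>
  Write \<open>f = \<mu>* - x\<^sup>T z\<close>. If there are only finitely many optimal pairs, then each optimal \<open>x\<close> is the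
  unique maximiser for its \<open>z\<close> and vice versa, so the normal \<open>(z, x)\<close> of \<open>f\<close> at the pair is a
  combination of all active constraint normals with strictly positive coefficients. Hence
  \<open>f = \<Sum> \<alpha>\<^sub>c g\<^sub>c\<close> over the active constraints, modulo the square of the maximal ideal of the pair.

  Membership in the quadratic module then follows from a version of Jacobi's representation
  theorem for modules. Let \<open>I\<close> be the ideal of polynomials bounded by a suitable order unit \<open>u\<close>
  that vanishes at the optimal pairs. If \<open>f\<close> were not in the quadratic module, a maximal cone avoiding
  \<open>-u\<close> would give a functional \<open>\<phi>\<close> on \<open>I\<close> with \<open>\<phi> (a h) = a(y) \<phi> h\<close> for some point \<open>y\<close> and \<open>\<phi> f \<le> 0\<close>.
  If \<open>y\<close> is not an optimal pair, \<open>\<phi>\<close> is a multiple of evaluation at a feasible point; if it is,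
  \<open>\<phi>\<close> kills second order terms and is nonnegative on the active constraints. In both cases
  \<open>\<phi> f > 0\<close>.
\<close>

section \<open>Evaluation and induction for polynomials\<close>

text \<open>The product runs over all variables: those missing from \<open>m\<close> have exponent 0
  and contribute the factor 1, so multiplicativity reduces to \<open>power_add\<close>.\<close>

definition eval :: "'v::finite rpoly \<Rightarrow> ('v \<Rightarrow> real) \<Rightarrow> real" where
  "eval p y = (\<Sum>m\<in>Poly_Mapping.keys p.
     Poly_Mapping.lookup p m * (\<Prod>v\<in>UNIV. y v ^ Poly_Mapping.lookup m v))"

lemma eval_superset:
  assumes "finite K" "Poly_Mapping.keys p \<subseteq> K"
  shows "eval p y = (\<Sum>m\<in>K. Poly_Mapping.lookup p m * (\<Prod>v\<in>UNIV. y v ^ Poly_Mapping.lookup m v))"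
  unfolding eval_def
  by (rule sum.mono_neutral_left) (use assms in \<open>auto simp: in_keys_iff\<close>)

lemma eval_single:
  "eval (Poly_Mapping.single m c) y = c * (\<Prod>v\<in>UNIV. y v ^ Poly_Mapping.lookup m v)"
  by (subst eval_superset[of "{m}"]) auto

lemma eval_add [simp]: "eval (p + q) y = eval p y + eval q y"
proof -
  let ?K = "Poly_Mapping.keys p \<union> Poly_Mapping.keys q"
  have "Poly_Mapping.keys (p + q) \<subseteq> ?K"
    by (rule keys_add)
  then show ?thesis
    by (subst (1 2 3) eval_superset[of ?K])
       (auto simp: lookup_add algebra_simps sum.distrib)
qed

lemma eval_zero [simp]: "eval 0 y = 0"
  by (simp add: eval_def)

text \<open>Updating at a fresh key is the same as adding a \<open>single\<close>. The rule serves
  polynomials and also monomials, which are finitely supported maps themselves.\<close>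

lemma poly_mapping_single_induct [case_names zero single add]:
  assumes "P 0" "\<And>m c. P (Poly_Mapping.single m c)" "\<And>p q. P p \<Longrightarrow> P q \<Longrightarrow> P (p + q)"
  shows "P p"
proof (induction p rule: update_induct)
  case const
  then show ?case by (rule assms)
next
  case (update p m c)
  have "Poly_Mapping.update m c p = p + Poly_Mapping.single m c"
    using update(1)
    by (intro poly_mapping_eqI) (auto simp: lookup_update lookup_add lookup_single when_def in_keys_iff)
  then show ?case
    using update assms by simp
qed

lemma eval_mult [simp]: "eval (p * q) y = eval p y * eval q y"
proof (induction p rule: poly_mapping_single_induct)
  case (single m c)
  show ?case
  proof (induction q rule: poly_mapping_single_induct)
    case (single n d)
    show ?case
      by (simp add: mult_single eval_single lookup_add power_add prod.distrib)
  qed (auto simp: algebra_simps)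
qed (auto simp: algebra_simps)

lemma eval_PConst [simp]: "eval (PConst c) y = c"
  by (simp add: PConst_def eval_single)

lemma eval_PVar [simp]: "eval (PVar v) y = y v"
proof -
  have "(\<Prod>w\<in>UNIV. y w ^ Poly_Mapping.lookup (Poly_Mapping.single v 1) w) = (\<Prod>w\<in>{v}. y w)"
    by (rule prod.mono_neutral_cong_right) (auto simp: lookup_single when_def)
  then show ?thesis
    by (simp add: PVar_def eval_single)
qed

lemma PConst_0 [simp]: "PConst 0 = 0"
  and PConst_1 [simp]: "PConst 1 = 1"
  and PConst_add: "PConst (a + b) = PConst a + PConst b"
  and PConst_diff: "PConst (a - b) = PConst a - PConst b"
  and PConst_minus: "PConst (- a) = - PConst a"
  and PConst_mult: "PConst (a * b) = PConst a * PConst b"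
  and PConst_numeral [simp]: "PConst (numeral n) = numeral n"
  by (simp_all add: PConst_def single_add single_diff single_uminus mult_single)

lemma PConst_power: "PConst (a ^ n) = PConst a ^ n"
  by (induction n) (auto simp: PConst_mult)

lemma PConst_sum: "PConst (\<Sum>i\<in>I. c i) = (\<Sum>i\<in>I. PConst (c i))"
  by (induction I rule: infinite_finite_induct) (auto simp: PConst_add)

lemma eval_1 [simp]: "eval 1 y = 1"
  using eval_PConst[of 1] by simp

lemma eval_minus [simp]: "eval (- p) y = - eval p y"
  using eval_add[of p "- p" y] by (simp del: eval_add)

lemma eval_diff [simp]: "eval (p - q) y = eval p y - eval q y"
  using eval_add[of p "- q" y] by (simp del: eval_add)

lemma eval_sum [simp]: "eval (\<Sum>i\<in>I. p i) y = (\<Sum>i\<in>I. eval (p i) y)"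
  by (induction I rule: infinite_finite_induct) auto

lemma eval_prod [simp]: "eval (\<Prod>i\<in>I. p i) y = (\<Prod>i\<in>I. eval (p i) y)"
  by (induction I rule: infinite_finite_induct) auto

lemma eval_power [simp]: "eval (p ^ n) y = eval p y ^ n"
  by (induction n) auto

text \<open>Constants and variables generate the ring: a polynomial is a sum of terms, a monomial a
  product of powers, a power a repeated product.\<close>

lemma rpoly_induct [case_names const var add mult]:
  fixes p :: "'v rpoly"
  assumes const: "\<And>c. P (PConst c)" and var: "\<And>v. P (PVar v)"
    and add: "\<And>p q. P p \<Longrightarrow> P q \<Longrightarrow> P (p + q)" and mult: "\<And>p q. P p \<Longrightarrow> P q \<Longrightarrow> P (p * q)"
  shows "P p"
proof (induction p rule: poly_mapping_single_induct)
  case zero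
  show ?case using const[of 0] by simp
next
  case (single m c)
  have pow: "P (Poly_Mapping.single (Poly_Mapping.single v n) 1)" for v n
  proof (induction n)
    case 0
    show ?case using const[of 1] by (simp add: PConst_def)
  next
    case (Suc n)
    have "Poly_Mapping.single (Poly_Mapping.single v (Suc n)) (1::real) =
        PVar v * Poly_Mapping.single (Poly_Mapping.single v n) 1"
      by (simp add: PVar_def mult_single flip: single_add)
    then show ?case using Suc var mult by simp
  qed
  have "P (Poly_Mapping.single m 1)"
  proof (induction m rule: poly_mapping_single_induct)
    case zero
    show ?case using const[of 1] by (simp add: PConst_def)
  next
    case (single v n)
    show ?case by (rule pow)
  next
    case (add m n)
    have "Poly_Mapping.single (m + n) (1::real) = Poly_Mapping.single m 1 * Poly_Mapping.single n 1"
      by (simp add: mult_single)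
    then show ?case using add mult by simp
  qed
  moreover have "Poly_Mapping.single m c = PConst c * Poly_Mapping.single m 1"
    by (simp add: PConst_def mult_single)
  ultimately show ?case using const mult by simp
qed (rule add)

section \<open>Cones over sums of squares\<close>

text \<open>A module over the semiring of sums of squares. It may omit 1, so that cones inside a
  proper ideal are covered.\<close>

definition sos_cone :: "'v rpoly set \<Rightarrow> bool" where
  "sos_cone C \<longleftrightarrow> 0 \<in> C \<and> (\<forall>p\<in>C. \<forall>q\<in>C. p + q \<in> C) \<and> (\<forall>p. \<forall>q\<in>C. p\<^sup>2 * q \<in> C)"

definition poly_ideal :: "'v rpoly set \<Rightarrow> bool" where
  "poly_ideal I \<longleftrightarrow> 0 \<in> I \<and> (\<forall>p\<in>I. \<forall>q\<in>I. p + q \<in> I) \<and> (\<forall>p. \<forall>q\<in>I. p * q \<in> I)"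

lemma sos_cone_zero: "sos_cone C \<Longrightarrow> 0 \<in> C"
  and sos_cone_add: "sos_cone C \<Longrightarrow> p \<in> C \<Longrightarrow> q \<in> C \<Longrightarrow> p + q \<in> C"
  and sos_cone_square: "sos_cone C \<Longrightarrow> q \<in> C \<Longrightarrow> p\<^sup>2 * q \<in> C"
  unfolding sos_cone_def by auto

lemma sos_cone_sum:
  assumes "sos_cone C" "\<And>i. i \<in> I \<Longrightarrow> p i \<in> C"
  shows "(\<Sum>i\<in>I. p i) \<in> C"
  using assms(2)
  by (induction I rule: infinite_finite_induct)
     (auto intro: sos_cone_zero[OF assms(1)] sos_cone_add[OF assms(1)])

lemma sos_cone_scale:
  assumes "sos_cone C" "p \<in> C" "0 \<le> c"
  shows "PConst c * p \<in> C"
  using sos_cone_square[OF assms(1,2), of "PConst (sqrt c)"] assms(3)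
  by (simp flip: PConst_power)

lemma sos_cone_sos:
  assumes "sos_cone C" "p \<in> C" "s \<in> sos"
  shows "s * p \<in> C"
proof -
  obtain n :: nat and q where "s = (\<Sum>i<n. (q i)\<^sup>2)"
    using assms(3) by (auto simp: sos_def)
  then show ?thesis
    by (auto simp: sum_distrib_right intro!: sos_cone_sum assms sos_cone_square)
qed

lemma zero_in_sos: "0 \<in> sos"
  by (auto simp: sos_def intro!: exI[of _ 0])

lemma sos_add_square:
  assumes "p \<in> sos"
  shows "p + r\<^sup>2 \<in> sos"
proof -
  obtain n :: nat and q where "p = (\<Sum>i<n. (q i)\<^sup>2)"
    using assms by (auto simp: sos_def)
  then have "p + r\<^sup>2 = (\<Sum>i<Suc n. ((q(n := r)) i)\<^sup>2)" by simp
  then show ?thesis unfolding sos_def by (intro CollectI exI)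
qed

lemma square_in_sos: "p\<^sup>2 \<in> sos"
  using sos_add_square[OF zero_in_sos] by simp

lemma sos_add:
  assumes "p \<in> sos" "q \<in> sos"
  shows "p + q \<in> sos"
proof -
  obtain n :: nat and q' where q: "q = (\<Sum>i<n. (q' i)\<^sup>2)"
    using assms(2) by (auto simp: sos_def)
  have "p + (\<Sum>i<n. (q' i)\<^sup>2) \<in> sos"
    by (induction n) (auto simp: assms(1) sos_add_square simp flip: add.assoc)
  then show ?thesis by (simp add: q)
qed

lemma sos_cone_of_sos: "sos_cone sos"
  unfolding sos_cone_def
proof (intro conjI allI ballI)
  show "0 \<in> sos" by (rule zero_in_sos)
next
  fix p q :: "'v rpoly"
  assume "q \<in> sos"
  then obtain n :: nat and q' where q: "q = (\<Sum>i<n. (q' i)\<^sup>2)"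
    by (auto simp: sos_def)
  have "p\<^sup>2 * q = (\<Sum>i<n. (p * q' i)\<^sup>2)"
    by (simp add: q sum_distrib_left power_mult_distrib)
  then show "p\<^sup>2 * q \<in> sos"
    unfolding sos_def by (intro CollectI exI)
qed (rule sos_add)

lemma one_in_sos: "1 \<in> sos"
  using square_in_sos[of 1] by simp

lemma PConst_in_sos: "0 \<le> c \<Longrightarrow> PConst c \<in> sos"
  using sos_cone_scale[OF sos_cone_of_sos one_in_sos] by simp

lemma sos_mult: "p \<in> sos \<Longrightarrow> q \<in> sos \<Longrightarrow> p * q \<in> sos"
  by (rule sos_cone_sos[OF sos_cone_of_sos])

lemma poly_idealD:
  assumes "poly_ideal I"
  shows "0 \<in> I" "p \<in> I \<Longrightarrow> q \<in> I \<Longrightarrow> p + q \<in> I" "q \<in> I \<Longrightarrow> p * q \<in> I"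
    "q \<in> I \<Longrightarrow> - q \<in> I" "p \<in> I \<Longrightarrow> q \<in> I \<Longrightarrow> p - q \<in> I"
proof -
  show 1: "0 \<in> I" "p \<in> I \<Longrightarrow> q \<in> I \<Longrightarrow> p + q \<in> I" "q \<in> I \<Longrightarrow> p * q \<in> I" for p q
    using assms by (auto simp: poly_ideal_def)
  show 2: "q \<in> I \<Longrightarrow> - q \<in> I" for q
    using 1(3)[of q "-1"] by simp
  show "p \<in> I \<Longrightarrow> q \<in> I \<Longrightarrow> p - q \<in> I"
    using 1(2)[of p "-q"] 2[of q] by simp
qed

text \<open>For a cone \<open>C\<close> this is the smallest cone containing \<open>C\<close> and
  \<open>a\<close>.\<close>

definition adjoin :: "'v rpoly set \<Rightarrow> 'v rpoly \<Rightarrow> 'v rpoly set" where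
  "adjoin C a = {c + s * a | c s. c \<in> C \<and> s \<in> sos}"

lemma
  assumes "sos_cone C"
  shows sos_cone_adjoin: "sos_cone (adjoin C a)"
    and adjoin_superset: "C \<subseteq> adjoin C a"
    and adjoin_new: "a \<in> adjoin C a"
proof -
  show "sos_cone (adjoin C a)"
    unfolding sos_cone_def
  proof (intro conjI allI ballI)
    show "0 \<in> adjoin C a"
      using sos_cone_zero[OF assms] zero_in_sos by (force simp: adjoin_def)
  next
    fix p q assume "p \<in> adjoin C a" "q \<in> adjoin C a"
    then obtain c s d t where *: "p = c + s * a" "q = d + t * a" "c \<in> C" "d \<in> C" "s \<in> sos" "t \<in> sos"
      by (auto simp: adjoin_def)
    then have "p + q = (c + d) + (s + t) * a" by (simp add: algebra_simps)
    then show "p + q \<in> adjoin C a"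
      using * sos_cone_add[OF assms] sos_add unfolding adjoin_def by blast
  next
    fix p q assume "q \<in> adjoin C a"
    then obtain d t where *: "q = d + t * a" "d \<in> C" "t \<in> sos"
      by (auto simp: adjoin_def)
    then have "p\<^sup>2 * q = p\<^sup>2 * d + (p\<^sup>2 * t) * a" by (simp add: algebra_simps)
    then show "p\<^sup>2 * q \<in> adjoin C a"
      using * sos_cone_square[OF assms] sos_cone_square[OF sos_cone_of_sos] unfolding adjoin_def by blast
  qed
  show "C \<subseteq> adjoin C a"
    using zero_in_sos by (force simp: adjoin_def)
  show "a \<in> adjoin C a"
    using sos_cone_zero[OF assms] one_in_sos by (force simp: adjoin_def)
qed

text \<open>Upper bounds for chains in Zorn's lemma: two members of the union already lie in a
  common cone of the chain.\<close>

lemma sos_cone_Union: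
  assumes "\<C> \<noteq> {}" "\<And>C. C \<in> \<C> \<Longrightarrow> sos_cone C" "\<And>C D. C \<in> \<C> \<Longrightarrow> D \<in> \<C> \<Longrightarrow> C \<subseteq> D \<or> D \<subseteq> C"
  shows "sos_cone (\<Union>\<C>)"
  unfolding sos_cone_def
proof (intro conjI allI ballI)
  show "0 \<in> \<Union>\<C>" using assms sos_cone_zero by blast
next
  fix p q assume "p \<in> \<Union>\<C>" "q \<in> \<Union>\<C>"
  then obtain C D where "p \<in> C" "q \<in> D" "C \<in> \<C>" "D \<in> \<C>" by blast
  then obtain E where "p \<in> E" "q \<in> E" "E \<in> \<C>" using assms(3)[of C D] by blast
  then show "p + q \<in> \<Union>\<C>" using assms(2) sos_cone_add by blast
next
  fix p q assume "q \<in> \<Union>\<C>"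
  then show "p\<^sup>2 * q \<in> \<Union>\<C>" using assms(2) sos_cone_square by blast
qed

text \<open>Only upper bounds are asked for; when \<open>I\<close> is an ideal, the bound for
  \<open>- h\<close> gives the lower one.\<close>

definition order_unit :: "'v rpoly set \<Rightarrow> 'v rpoly \<Rightarrow> 'v rpoly set \<Rightarrow> bool" where
  "order_unit C u I \<longleftrightarrow> u \<in> C \<and> (\<forall>h\<in>I. \<exists>N. PConst N * u - h \<in> C)"

text \<open>The trick behind this step: \<open>(K - s)\<^sup>2 (f + r u)\<close> lies in \<open>C\<close>, and expanding it with
  \<open>s f \<in> u + C\<close> shows that \<open>r\<close> can be lowered by \<open>1 / K\<^sup>2\<close>.\<close>

lemma mem_cone_if_sos_multiple:
  assumes C: "sos_cone C" and I: "poly_ideal I" and CI: "C \<subseteq> I" and u: "order_unit C u I"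
    and f: "f \<in> I" and s: "s \<in> sos" and sf: "s * f - u \<in> C"
  shows "f \<in> C"
proof (rule ccontr)
  assume nf: "f \<notin> C"
  have uC: "u \<in> C" and uI: "u \<in> I" using u CI by (auto simp: order_unit_def)
  have bnd: "\<exists>N. PConst N * u - h \<in> C" if "h \<in> I" for h
    using u that by (auto simp: order_unit_def)
  define q where "q = s * f - u"
  have sfq: "s * f = u + q" by (simp add: q_def)
  have qC: "q \<in> C" and qI: "q \<in> I" using sf CI by (auto simp: q_def)
  \<comment> \<open>These constants absorb the terms \<open>s * q\<close>, \<open>s * u\<close> and
    \<open>s * s * u\<close> that the expansion leaves over.\<close>
  obtain K1 where K1: "PConst K1 * u - s * q \<in> C" using bnd poly_idealD(3)[OF I qI] by blast
  obtain K2 where K2: "PConst K2 * u - s * u \<in> C" using bnd poly_idealD(3)[OF I uI] by blast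
  obtain K3 where K3: "PConst K3 * u - s * s * u \<in> C" using bnd poly_idealD(3)[OF I uI] by blast
  \<comment> \<open>All elements of \<open>R\<close> are positive because
    \<open>f \<notin> C\<close>, yet those close to the infimum can be lowered by a fixed
    amount.\<close>
  define R where "R = {r. f + PConst r * u \<in> C}"
  have Rpos: "r > 0" if "r \<in> R" for r
  proof (rule ccontr)
    assume "\<not> r > 0"
    then have "PConst (- r) * u \<in> C" using sos_cone_scale[OF C uC] by simp
    moreover have "f + PConst r * u \<in> C" using that by (simp add: R_def)
    ultimately have "(f + PConst r * u) + PConst (- r) * u \<in> C" by (rule sos_cone_add[OF C, rotated])
    then show False using nf by (simp add: PConst_minus algebra_simps)
  qed
  obtain K0 where K0: "PConst K0 * u - (- f) \<in> C" using bnd poly_idealD(4)[OF I f] by blast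
  then have "K0 \<in> R" by (simp add: R_def add.commute)
  have bdd: "bdd_below R" using Rpos by (intro bdd_belowI[of _ 0]) force
  \<comment> \<open>The decrement must not depend on \<open>r\<close>, while the requirement on
    \<open>K\<close> grows with \<open>r\<close>; capping \<open>r\<close> at
    \<open>Inf R + 1\<close> allows a single \<open>K\<close>.\<close>
  define r1 where "r1 = Inf R + 1"
  have r1: "r1 \<ge> 0" using cInf_greatest[of R 0] \<open>K0 \<in> R\<close> Rpos by (force simp: r1_def)
  define K where "K = 1 + \<bar>K1\<bar> + \<bar>K2\<bar> + r1 * \<bar>K3\<bar>"
  have K: "K \<ge> 1" using r1 by (simp add: K_def)
  have step: "r - 1 / K\<^sup>2 \<in> R" if r: "r \<in> R" "r \<le> r1" for r
  proof -
    let ?k = "PConst K" and ?r = "PConst r"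
    have r0: "r \<ge> 0" using Rpos[OF r(1)] by simp
    have "r * K3 \<le> r1 * \<bar>K3\<bar>"
      using r r0 by (metis abs_ge_self abs_ge_zero mult_left_mono mult_right_mono order_trans)
    moreover have "r1 * \<bar>K3\<bar> \<ge> 0" using r1 by simp
    moreover have "K = 1 + \<bar>K1\<bar> + \<bar>K2\<bar> + r1 * \<bar>K3\<bar>" by (simp add: K_def)
    ultimately have "2 * K - 1 - K1 - K2 - r * K3 \<ge> 0" by argo
    then have c6: "PConst (2 * K - 1 - K1 - K2 - r * K3) * u \<in> C"
      by (rule sos_cone_scale[OF C uC])
    have c1: "(?k - s)\<^sup>2 * (f + ?r * u) \<in> C" using r(1) by (intro sos_cone_square[OF C]) (simp add: R_def)
    have c2: "PConst (2 * K) * q \<in> C" using sos_cone_scale[OF C qC] K by simp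
    have c3: "PConst (2 * K * r) * (s * u) \<in> C"
      using sos_cone_scale[OF C sos_cone_sos[OF C uC s]] K r0 by simp
    have c5: "?r * (PConst K3 * u - s * s * u) \<in> C" using sos_cone_scale[OF C K3 r0] .
    note cs = sos_cone_add[OF C sos_cone_add[OF C sos_cone_add[OF C sos_cone_add[OF C
        sos_cone_add[OF C sos_cone_add[OF C c1 c2] c3] K1] K2] c5] c6]
    \<comment> \<open>The weights are chosen so that, after replacing \<open>s * f\<close> by
      \<open>u + q\<close>, all terms with \<open>s\<close> or \<open>q\<close> cancel and
      \<open>?k\<^sup>2 * (f + ?r * u) - u\<close> remains.\<close>
    let ?z = "(?k - s)\<^sup>2 * (f + ?r * u) + PConst (2 * K) * q + PConst (2 * K * r) * (s * u) +
        (PConst K1 * u - s * q) + (PConst K2 * u - s * u) + ?r * (PConst K3 * u - s * s * u) +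
        PConst (2 * K - 1 - K1 - K2 - r * K3) * u"
    have "?z = ?k\<^sup>2 * f - 2 * ?k * (s * f) + s * (s * f) + ?k\<^sup>2 * ?r * u + 2 * ?k * q + 2 * ?k * u - u
        - s * q - s * u"
      by (simp add: PConst_mult PConst_diff PConst_add algebra_simps power2_eq_square)
    also have "\<dots> = ?k\<^sup>2 * f + ?k\<^sup>2 * ?r * u - u"
      unfolding sfq by (simp add: algebra_simps)
    finally have "?k\<^sup>2 * f + ?k\<^sup>2 * ?r * u - u \<in> C" using cs by simp
    from sos_cone_scale[OF C this, of "1 / K\<^sup>2"]
    have "PConst (1 / K\<^sup>2) * ?k\<^sup>2 * f + PConst (1 / K\<^sup>2) * ?k\<^sup>2 * ?r * u - PConst (1 / K\<^sup>2) * u \<in> C"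
      by (simp add: algebra_simps)
    moreover have "PConst (1 / K\<^sup>2) * ?k\<^sup>2 = (1 :: 'a rpoly)"
      using K by (simp flip: PConst_power PConst_mult)
    ultimately show ?thesis
      by (simp add: R_def PConst_diff algebra_simps)
  qed
  obtain r where r: "r \<in> R" "r < Inf R + 1 / K\<^sup>2"
    using cInf_lessD[of R "Inf R + 1 / K\<^sup>2"] \<open>K0 \<in> R\<close> K by auto
  have "1 / K\<^sup>2 \<le> 1" using K by simp
  then have "r - 1 / K\<^sup>2 \<in> R" using r step by (simp add: r1_def)
  then have "Inf R \<le> r - 1 / K\<^sup>2" by (rule cInf_lower[OF _ bdd])
  then show False using r by simp
qed

section \<open>States of cones with an order unit\<close>

text \<open>Zorn's lemma on the cones between \<open>C\<close> and \<open>I\<close> that avoid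
  \<open>x\<close>, chains being bounded by their unions.\<close>

lemma maximal_cone_exists:
  assumes C: "sos_cone C" and "C \<subseteq> I" and "x \<notin> C"
  obtains D where "sos_cone D" "C \<subseteq> D" "D \<subseteq> I" "x \<notin> D"
    "\<And>E. sos_cone E \<Longrightarrow> D \<subseteq> E \<Longrightarrow> E \<subseteq> I \<Longrightarrow> x \<notin> E \<Longrightarrow> E = D"
proof -
  define F where "F = {D. sos_cone D \<and> C \<subseteq> D \<and> D \<subseteq> I \<and> x \<notin> D}"
  have "\<exists>M\<in>F. \<forall>X\<in>F. M \<subseteq> X \<longrightarrow> X = M"
  proof (rule subset_Zorn_nonempty)
    show "F \<noteq> {}" using assms by (auto simp: F_def)
    fix \<C> assume "\<C> \<noteq> {}" "subset.chain F \<C>"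
    then have sub: "\<C> \<subseteq> F" and ch: "\<And>C D. C \<in> \<C> \<Longrightarrow> D \<in> \<C> \<Longrightarrow> C \<subseteq> D \<or> D \<subseteq> C"
      by (auto simp: subset_chain_def)
    have "sos_cone (\<Union>\<C>)"
      by (rule sos_cone_Union[OF \<open>\<C> \<noteq> {}\<close> _ ch]) (use sub in \<open>auto simp: F_def\<close>)
    then show "\<Union>\<C> \<in> F"
      using sub \<open>\<C> \<noteq> {}\<close> unfolding F_def by blast
  qed
  then obtain D where D: "D \<in> F" "\<And>E. E \<in> F \<Longrightarrow> D \<subseteq> E \<Longrightarrow> E = D" by blast
  show thesis
  proof (rule that)
    show "sos_cone D" "C \<subseteq> D" "D \<subseteq> I" "x \<notin> D" using D(1) by (auto simp: F_def)
    then show "E = D" if "sos_cone E" "D \<subseteq> E" "E \<subseteq> I" "x \<notin> E" for E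
      using that D(2)[of E] by (auto simp: F_def)
  qed
qed

text \<open>If \<open>D\<close> contained neither \<open>h\<close> nor \<open>- h\<close>,
  maximality would put \<open>- u\<close> into both enlarged cones. Cross-multiplying the two
  representations eliminates \<open>h\<close> and gives \<open>- (s * u) \<in> D\<close>. Then the
  order unit bound on \<open>h\<close> yields \<open>s * h \<in> D\<close>, hence
  \<open>- u \<in> D\<close>.\<close>

lemma maximal_cone_total:
  assumes D: "sos_cone D" and DI: "D \<subseteq> I" and I: "poly_ideal I"
    and u: "order_unit D u I" and nu: "- u \<notin> D"
    and max: "\<And>E. sos_cone E \<Longrightarrow> D \<subseteq> E \<Longrightarrow> E \<subseteq> I \<Longrightarrow> - u \<notin> E \<Longrightarrow> E = D"
    and h: "h \<in> I"
  shows "h \<in> D \<or> - h \<in> D"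
proof (rule ccontr)
  assume *: "\<not> (h \<in> D \<or> - h \<in> D)"
  have uD: "u \<in> D" using u by (simp add: order_unit_def)
  have rep: "\<exists>q\<in>D. \<exists>s\<in>sos. - u = q + s * a" if "a \<in> I" "a \<notin> D" for a
  proof -
    have "adjoin D a \<subseteq> I"
      using DI poly_idealD[OF I] that(1) by (auto simp: adjoin_def)
    then have "- u \<in> adjoin D a"
      using max[OF sos_cone_adjoin[OF D] adjoin_superset[OF D]] adjoin_new[OF D, of a] that(2) by blast
    then show ?thesis by (auto simp: adjoin_def)
  qed
  obtain q s where q: "q \<in> D" "s \<in> sos" and e1: "- u = q + s * h"
    using rep[of h] h * by blast
  obtain q' t where q': "q' \<in> D" "t \<in> sos" and e2: "- u = q' + t * (- h)"
    using rep[of "- h"] h * poly_idealD(4)[OF I] by blast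
  have "t * (- u) + s * (- u) = t * q + s * q'"
    by (subst e1, subst e2) (simp add: algebra_simps)
  then have "- (s * u) = t * q + s * q' + t * u"
    by (simp add: algebra_simps)
  moreover have "t * q + s * q' + t * u \<in> D"
    by (intro sos_cone_add[OF D] sos_cone_sos[OF D] q q' uD)
  ultimately have su: "- (s * u) \<in> D" by simp
  obtain N where N: "PConst N * u - (- h) \<in> D"
    using u poly_idealD(4)[OF I h] by (auto simp: order_unit_def)
  \<comment> \<open>The multiple of \<open>- (s * u)\<close> added below needs a nonnegative
    coefficient, hence the passage to \<open>\<bar>N\<bar>\<close>.\<close>
  have "PConst (\<bar>N\<bar> - N) * u \<in> D" by (rule sos_cone_scale[OF D uD]) simp
  from sos_cone_add[OF D N this] have "PConst \<bar>N\<bar> * u + h \<in> D"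
    by (simp add: PConst_diff algebra_simps)
  then have "s * (PConst \<bar>N\<bar> * u + h) \<in> D" by (rule sos_cone_sos[OF D _ q(2)])
  then have "s * (PConst \<bar>N\<bar> * u + h) + PConst \<bar>N\<bar> * (- (s * u)) \<in> D"
    by (intro sos_cone_add[OF D] sos_cone_scale[OF D su]) auto
  then have "s * h \<in> D" by (simp add: algebra_simps)
  then have "- u \<in> D" unfolding e1 by (rule sos_cone_add[OF D q(1)])
  then show False using nu by blast
qed

text \<open>Polarisation: statements about multiplication by squares extend to arbitrary
  multipliers.\<close>

lemma quarter_square_diff: "(a :: 'v rpoly) = PConst (1/4) * (a + 1)\<^sup>2 - PConst (1/4) * (a - 1)\<^sup>2"
proof -
  have "PConst (1/4) * (a + 1)\<^sup>2 - PConst (1/4) * (a - 1)\<^sup>2 = PConst (1/4) * PConst 4 * a"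
    by (simp add: power2_eq_square algebra_simps)
  also have "\<dots> = a"
    by (simp flip: PConst_mult del: PConst_numeral)
  finally show ?thesis by simp
qed

text \<open>A total cone with an order unit carries a unique state, and totality forces that state to be
  multiplicative.\<close>

lemma total_cone_state:
  fixes u :: "'v::finite rpoly"
  assumes D: "sos_cone D" and DI: "D \<subseteq> I" and I: "poly_ideal I"
    and u: "order_unit D u I" and nu: "- u \<notin> D"
    and total: "\<And>h. h \<in> I \<Longrightarrow> h \<in> D \<or> - h \<in> D"
  obtains \<phi> y where "\<And>p q. p \<in> I \<Longrightarrow> q \<in> I \<Longrightarrow> \<phi> (p + q) = \<phi> p + \<phi> q"
    "\<And>a h. h \<in> I \<Longrightarrow> \<phi> (a * h) = eval a y * \<phi> h"
    "\<And>h. h \<in> D \<Longrightarrow> 0 \<le> \<phi> h" "\<phi> u = (1 :: real)"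
proof -
  have uD: "u \<in> D" using u by (simp add: order_unit_def)
  then have uI: "u \<in> I" using DI by blast
  have neg: "c \<ge> 0" if "PConst c * u \<in> D" for c
  proof (rule ccontr)
    assume "\<not> c \<ge> 0"
    then have "PConst (- 1 / c) * (PConst c * u) \<in> D"
      by (intro sos_cone_scale[OF D that]) (auto simp: divide_simps)
    moreover have "PConst (- 1 / c) * PConst c = (- 1 :: 'v rpoly)"
      using \<open>\<not> c \<ge> 0\<close> by (simp add: PConst_minus flip: PConst_mult)
    ultimately show False using nu by (simp flip: mult.assoc)
  qed
  \<comment> \<open>\<open>s\<close> is the value of \<open>h\<close> if \<open>h\<close> is
    squeezed between multiples of \<open>u\<close> just below and just above \<open>s\<close>. The
    slack is there because \<open>D\<close> need not contain limits.\<close>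
  define val where "val h s \<longleftrightarrow> (\<forall>\<epsilon>>0. h - PConst (s - \<epsilon>) * u \<in> D \<and> PConst (s + \<epsilon>) * u - h \<in> D)" for h s
  have val_ex: "\<exists>s. val h s" if h: "h \<in> I" for h
  proof -
    \<comment> \<open>The value is the supremum of the lower bounds. Above it
      \<open>h - PConst r * u\<close> is outside \<open>D\<close>, so totality puts its negative
      inside.\<close>
    define L where "L = {r. h - PConst r * u \<in> D}"
    obtain N where N: "PConst N * u - h \<in> D" using u h by (auto simp: order_unit_def)
    obtain N' where N': "PConst N' * u - (- h) \<in> D"
      using u poly_idealD(4)[OF I h] by (auto simp: order_unit_def)
    have ne: "- N' \<in> L" using N' by (simp add: L_def PConst_minus add.commute)
    have bdd: "bdd_above L"
    proof (rule bdd_aboveI)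
      fix r assume "r \<in> L"
      then have "(h - PConst r * u) + (PConst N * u - h) \<in> D"
        unfolding L_def by (intro sos_cone_add[OF D _ N]) simp
      then have "PConst (N - r) * u \<in> D" by (simp add: PConst_diff algebra_simps)
      then show "r \<le> N" using neg by fastforce
    qed
    have "h - PConst (Sup L - \<epsilon>) * u \<in> D \<and> PConst (Sup L + \<epsilon>) * u - h \<in> D" if "\<epsilon> > 0" for \<epsilon>
    proof
      have "L \<noteq> {}" "Sup L - \<epsilon> < Sup L" using ne that by auto
      from less_cSupD[OF this] obtain r where r: "r \<in> L" "Sup L - \<epsilon> < r" by blast
      then have "(h - PConst r * u) + PConst (r - (Sup L - \<epsilon>)) * u \<in> D"
        by (intro sos_cone_add[OF D] sos_cone_scale[OF D uD]) (auto simp: L_def)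
      then show "h - PConst (Sup L - \<epsilon>) * u \<in> D" by (simp add: PConst_diff PConst_add algebra_simps)
      have "Sup L + \<epsilon> \<notin> L" using cSup_upper[OF _ bdd, of "Sup L + \<epsilon>"] that by auto
      then show "PConst (Sup L + \<epsilon>) * u - h \<in> D"
        using total[of "h - PConst (Sup L + \<epsilon>) * u"] poly_idealD(3,5)[OF I] h uI by (auto simp: L_def)
    qed
    then show ?thesis unfolding val_def by blast
  qed
  have val_le: "s \<le> t" if "val h s" "val h t" for h s t
  proof (rule ccontr)
    assume "\<not> s \<le> t"
    \<comment> \<open>With a third of the gap, \<open>t + e - (s - e) = - e < 0\<close>, against
      \<open>neg\<close>.\<close>
    define e where "e = (s - t) / 3"
    have e: "e > 0" using \<open>\<not> s \<le> t\<close> by (simp add: e_def)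
    have "(h - PConst (s - e) * u) + (PConst (t + e) * u - h) \<in> D"
      by (intro sos_cone_add[OF D]) (use that e in \<open>auto simp: val_def\<close>)
    then have "PConst (t + e - (s - e)) * u \<in> D" by (simp add: PConst_diff PConst_add PConst_mult algebra_simps)
    then show False using neg e by (fastforce simp: e_def field_simps)
  qed
  define \<phi> where "\<phi> h = (THE s. val h s)" for h
  have phiI: "\<phi> h = s" if "val h s" for h s
    unfolding \<phi>_def using that val_le by (intro the_equality) (auto intro: antisym)
  have phi: "val h (\<phi> h)" if "h \<in> I" for h
    using val_ex[OF that] phiI by blast
  have phi_add: "\<phi> (p + q) = \<phi> p + \<phi> q" if "p \<in> I" "q \<in> I" for p q
  proof (rule phiI, unfold val_def, intro allI impI)
    fix e :: real assume "e > 0"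
    then have *: "e / 2 > 0" by simp
    have **: "s + t + e = (s + e/2) + (t + e/2)" "s + t - e = (s - e/2) + (t - e/2)" for s t by auto
    have 1: "(p - PConst (\<phi> p - e/2) * u) + (q - PConst (\<phi> q - e/2) * u) \<in> D"
      using phi[OF that(1)] phi[OF that(2)] * by (auto simp: val_def intro!: sos_cone_add[OF D])
    have 2: "(PConst (\<phi> p + e/2) * u - p) + (PConst (\<phi> q + e/2) * u - q) \<in> D"
      using phi[OF that(1)] phi[OF that(2)] * by (auto simp: val_def intro!: sos_cone_add[OF D])
    show "p + q - PConst (\<phi> p + \<phi> q - e) * u \<in> D \<and> PConst (\<phi> p + \<phi> q + e) * u - (p + q) \<in> D"
      unfolding ** PConst_add[of "_ + e/2"] PConst_add[of "_ - e/2"] using 1 2 by (simp only: algebra_simps)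
  qed
  have phi_const: "\<phi> (PConst c * u) = c" for c
  proof (rule phiI, unfold val_def, intro allI impI)
    fix e :: real assume "e > 0"
    then have "PConst e * u \<in> D" by (intro sos_cone_scale[OF D uD]) simp
    then show "PConst c * u - PConst (c - e) * u \<in> D \<and> PConst (c + e) * u - PConst c * u \<in> D"
      by (simp add: PConst_diff PConst_add algebra_simps)
  qed
  have phi_pos: "\<phi> h \<ge> 0" if "h \<in> D" for h
  proof (rule ccontr)
    assume *: "\<not> \<phi> h \<ge> 0"
    define e where "e = - \<phi> h / 2"
    have "e > 0" using * by (simp add: e_def)
    moreover have "val h (\<phi> h)" using phi that DI by blast
    ultimately have "PConst (\<phi> h + e) * u - h \<in> D"
      unfolding val_def by blast
    from sos_cone_add[OF D this that] have "PConst (\<phi> h + e) * u \<in> D" by simp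
    then show False using neg * by (fastforce simp: e_def)
  qed
  have phi_minus: "\<phi> (- h) = - \<phi> h" if "h \<in> I" for h
    using phi_add[OF that poly_idealD(4)[OF I that]] phi_const[of 0] by simp
  have phi_diff: "\<phi> (p - q) = \<phi> p - \<phi> q" if "p \<in> I" "q \<in> I" for p q
    using phi_add[OF that(1) poly_idealD(4)[OF I that(2)]] phi_minus[OF that(2)] by simp
  have phi_scale_pos: "\<phi> (PConst c * h) = c * \<phi> h" if "h \<in> I" "c > 0" for c h
  proof (rule phiI, unfold val_def, intro allI impI)
    fix e :: real assume "e > 0"
    then have "h - PConst (\<phi> h - e / c) * u \<in> D" "PConst (\<phi> h + e / c) * u - h \<in> D"
      using phi[OF that(1)] that(2) by (auto simp: val_def)
    then have "PConst c * (h - PConst (\<phi> h - e / c) * u) \<in> D" "PConst c * (PConst (\<phi> h + e / c) * u - h) \<in> D"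
      using that(2) by (auto intro!: sos_cone_scale[OF D])
    moreover have "PConst c * (PConst s * u) = PConst (c * s) * u" for s
      by (simp add: PConst_mult)
    ultimately show "PConst c * h - PConst (c * \<phi> h - e) * u \<in> D \<and> PConst (c * \<phi> h + e) * u - PConst c * h \<in> D"
      using that(2) by (simp add: right_diff_distrib distrib_left)
  qed
  have phi_scale: "\<phi> (PConst c * h) = c * \<phi> h" if "h \<in> I" for c h
  proof (cases c "0 :: real" rule: linorder_cases)
    case less
    have "\<phi> (- (PConst (- c) * h)) = - (- c * \<phi> h)"
      using less that by (subst phi_minus) (auto simp: phi_scale_pos intro: poly_idealD(3)[OF I])
    then show ?thesis by (simp add: PConst_minus)
  qed (use that phi_scale_pos phi_const[of 0] in auto)
  \<comment> \<open>Multiplying the squeeze on \<open>h\<close> by \<open>b\<^sup>2\<close> stays in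
    \<open>D\<close> and traps \<open>\<phi> (b\<^sup>2 * h)\<close> between
    \<open>(\<phi> h - e) * ?w\<close> and \<open>(\<phi> h + e) * ?w\<close>; then \<open>e\<close>
    tends to 0.\<close>
  have phi_square: "\<phi> (b\<^sup>2 * h) = \<phi> (b\<^sup>2 * u) * \<phi> h" if h: "h \<in> I" for b h
  proof -
    let ?w = "\<phi> (b\<^sup>2 * u)" and ?t = "\<phi> (b\<^sup>2 * h)"
    have w: "?w \<ge> 0" by (intro phi_pos sos_cone_square[OF D] uD)
    have 1: "(\<phi> h - e) * ?w \<le> ?t" "?t \<le> (\<phi> h + e) * ?w" if "e > 0" for e
    proof -
      have "h - PConst (\<phi> h - e) * u \<in> D" "PConst (\<phi> h + e) * u - h \<in> D"
        using phi[OF h] that by (auto simp: val_def)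
      then have "0 \<le> \<phi> (b\<^sup>2 * (h - PConst (\<phi> h - e) * u))" "0 \<le> \<phi> (b\<^sup>2 * (PConst (\<phi> h + e) * u - h))"
        by (auto intro!: phi_pos sos_cone_square[OF D])
      moreover have "b\<^sup>2 * (h - PConst r * u) = b\<^sup>2 * h - PConst r * (b\<^sup>2 * u)"
        "b\<^sup>2 * (PConst r * u - h) = PConst r * (b\<^sup>2 * u) - b\<^sup>2 * h" for r
        by (simp_all add: algebra_simps)
      ultimately show "(\<phi> h - e) * ?w \<le> ?t" "?t \<le> (\<phi> h + e) * ?w"
        using h uI by (auto simp: phi_diff phi_scale poly_idealD(3)[OF I])
    qed
    have small: "x \<le> y" if "\<And>e. e > 0 \<Longrightarrow> x \<le> y + e * ?w" for x y
    proof (rule field_le_epsilon)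
      fix e :: real assume "e > 0"
      \<comment> \<open>Dividing by \<open>?w + 1\<close> instead of \<open>?w\<close> covers
        \<open>?w = 0\<close>.\<close>
      have "x \<le> y + e / (?w + 1) * ?w" using that[of "e / (?w + 1)"] w \<open>e > 0\<close> by auto
      also have "e / (?w + 1) * ?w \<le> e" using w \<open>e > 0\<close> by (simp add: field_simps)
      finally show "x \<le> y + e" by simp
    qed
    have "?t \<le> \<phi> h * ?w" "\<phi> h * ?w \<le> ?t"
      by (rule small; use 1 in \<open>force simp: algebra_simps\<close>)+
    then show ?thesis by (simp add: mult.commute)
  qed
  have phi_mult: "\<phi> (a * h) = \<phi> (a * u) * \<phi> h" if h: "h \<in> I" for a h
  proof -
    have "\<phi> (a * k) = 1/4 * \<phi> ((a + 1)\<^sup>2 * k) - 1/4 * \<phi> ((a - 1)\<^sup>2 * k)" if "k \<in> I" for k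
    proof -
      have "a * k = PConst (1/4) * ((a + 1)\<^sup>2 * k) - PConst (1/4) * ((a - 1)\<^sup>2 * k)"
        by (subst quarter_square_diff[of a]) (simp add: algebra_simps)
      then show ?thesis
        using that by (simp add: phi_diff phi_scale poly_idealD(3)[OF I])
    qed
    note quarter = this
    show ?thesis
      unfolding quarter[OF h] quarter[OF uI] phi_square[OF h] by (simp add: left_diff_distrib)
  qed
  \<comment> \<open>By \<open>phi_mult\<close>, sending \<open>a\<close> to
    \<open>\<phi> (a * u)\<close> is a ring homomorphism to the reals, hence evaluation at the
    images of the variables.\<close>
  define y where "y v = \<phi> (PVar v * u)" for v
  have phi_u: "\<phi> u = 1" using phi_const[of 1] by simp
  have phi_eval: "\<phi> (a * h) = eval a y * \<phi> h" if "h \<in> I" for a h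
    using that
  proof (induction a arbitrary: h rule: rpoly_induct)
    case (const c)
    then show ?case by (simp add: phi_scale)
  next
    case (var v)
    then show ?case using phi_mult[of h "PVar v"] by (simp add: y_def)
  next
    case (add p q)
    then show ?case by (simp add: distrib_right phi_add poly_idealD(3)[OF I])
  next
    case (mult p q)
    then show ?case by (simp add: mult.assoc poly_idealD(3)[OF I])
  qed
  show thesis by (rule that[of \<phi> y]) (use phi_add phi_eval phi_pos phi_u in auto)
qed

text \<open>If adjoining \<open>- f\<close> produces \<open>- u\<close>, then
  \<open>s * f - u \<in> C\<close> for some sum of squares \<open>s\<close>, and
  \<open>mem_cone_if_sos_multiple\<close> applies. Otherwise a maximal cone containing
  \<open>- f\<close> carries a state with \<open>\<phi> f \<le> 0\<close>, which \<open>pos\<close>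
  excludes.\<close>

theorem mem_cone_if_states_positive:
  fixes f :: "'v::finite rpoly"
  assumes C: "sos_cone C" and I: "poly_ideal I" and CI: "C \<subseteq> I" and u: "order_unit C u I"
    and f: "f \<in> I"
    and pos: "\<And>\<phi> y. \<lbrakk>\<And>p q. p \<in> I \<Longrightarrow> q \<in> I \<Longrightarrow> \<phi> (p + q) = \<phi> p + \<phi> q;
      \<And>a h. h \<in> I \<Longrightarrow> \<phi> (a * h) = eval a y * \<phi> h;
      \<And>h. h \<in> C \<Longrightarrow> 0 \<le> \<phi> h; \<phi> u = (1 :: real)\<rbrakk> \<Longrightarrow> 0 < \<phi> f"
  shows "f \<in> C"
proof (cases "- u \<in> adjoin C (- f)")
  case True
  then obtain c s where cs: "c \<in> C" "s \<in> sos" "- u = c + s * (- f)" by (auto simp: adjoin_def)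
  then have "s * f - u = c" by (simp add: algebra_simps)
  then show ?thesis using mem_cone_if_sos_multiple[OF C I CI u f cs(2)] cs(1) by simp
next
  case False
  have "adjoin C (- f) \<subseteq> I"
    using CI f poly_idealD[OF I] by (auto simp: adjoin_def)
  then obtain D where D: "sos_cone D" "adjoin C (- f) \<subseteq> D" "D \<subseteq> I" "- u \<notin> D"
    and max: "\<And>E. sos_cone E \<Longrightarrow> D \<subseteq> E \<Longrightarrow> E \<subseteq> I \<Longrightarrow> - u \<notin> E \<Longrightarrow> E = D"
    using maximal_cone_exists[OF sos_cone_adjoin[OF C] _ False] by metis
  have CD: "C \<subseteq> D" and fD: "- f \<in> D"
    using D(2) adjoin_superset[OF C] adjoin_new[OF C] by blast+
  have uD: "order_unit D u I" using u CD unfolding order_unit_def by blast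
  have total: "h \<in> D \<or> - h \<in> D" if "h \<in> I" for h
    using maximal_cone_total[OF D(1,3) I uD D(4) max that] by blast
  obtain \<phi> y where phi: "\<And>p q. p \<in> I \<Longrightarrow> q \<in> I \<Longrightarrow> \<phi> (p + q) = \<phi> p + \<phi> q"
    "\<And>a h. h \<in> I \<Longrightarrow> \<phi> (a * h) = eval a y * \<phi> h"
    "\<And>h. h \<in> D \<Longrightarrow> 0 \<le> \<phi> h" "\<phi> u = (1 :: real)"
    using total_cone_state[OF D(1,3) I uD D(4) total] by blast
  have "0 < \<phi> f" by (rule pos[OF phi(1,2) _ phi(4)]) (use phi(3) CD in auto)
  moreover have "\<phi> (- f) = - \<phi> f"
    using phi(2)[OF f, of "- 1"] by simp
  ultimately show ?thesis using phi(3)[OF fD] by simp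
qed

section \<open>Ideals of order-bounded polynomials\<close>

text \<open>Modulo \<open>I\<close> every variable equals a constant, so every polynomial is
  congruent to its value at \<open>y\<close>.\<close>

lemma vanishing_mem_ideal:
  assumes I: "poly_ideal I" and gen: "\<And>v. PVar v - PConst (y v) \<in> I" and p: "eval p y = 0"
  shows "p \<in> I"
proof -
  have "p - PConst (eval p y) \<in> I"
  proof (induction p rule: rpoly_induct)
    case (const c)
    then show ?case by (simp add: poly_idealD(1)[OF I])
  next
    case (var v)
    then show ?case by (simp add: gen)
  next
    case (add p q)
    then have "(p - PConst (eval p y)) + (q - PConst (eval q y)) \<in> I"
      by (rule poly_idealD(2)[OF I])
    then show ?case by (simp add: PConst_add algebra_simps)
  next
    case (mult p q)
    then have "q * (p - PConst (eval p y)) + PConst (eval p y) * (q - PConst (eval q y)) \<in> I"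
      by (intro poly_idealD(2,3)[OF I])
    then show ?case by (simp add: PConst_mult algebra_simps)
  qed
  then show ?thesis using p by simp
qed

lemma poly_ideal_cancel_const: "poly_ideal I \<Longrightarrow> PConst c * p \<in> I \<Longrightarrow> c \<noteq> 0 \<Longrightarrow> p \<in> I"
  using poly_idealD(3)[of I "PConst c * p" "PConst (1 / c)"]
  by (simp flip: mult.assoc PConst_mult)

text \<open>Since all \<open>\<delta> w\<close> are nonzero, \<open>e\<^sup>2\<close> is coprime to
  the product of the other squares. Peeling off one factor at a time reduces this to two
  squares.\<close>

lemma mem_ideal_if_coprime_squares:
  assumes I: "poly_ideal I" and "finite G" and "\<And>w. w \<in> G \<Longrightarrow> \<delta> w \<noteq> 0"
    and "e\<^sup>2 * d \<in> I" and "(\<Prod>w\<in>G. (e + PConst (\<delta> w))\<^sup>2) * d \<in> I"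
  shows "d \<in> I"
  using assms(2-)
proof (induction G arbitrary: d rule: finite_induct)
  case (insert w G)
  let ?c = "PConst (\<delta> w)"
  have nz: "\<delta> w \<noteq> 0" by (rule insert.prems) simp
  have "(e + ?c)\<^sup>2 * d \<in> I"
  proof (rule insert.IH)
    show "e\<^sup>2 * ((e + ?c)\<^sup>2 * d) \<in> I"
      using poly_idealD(3)[OF I insert.prems(2), of "(e + ?c)\<^sup>2"] by (simp add: mult.left_commute)
    show "(\<Prod>w\<in>G. (e + PConst (\<delta> w))\<^sup>2) * ((e + ?c)\<^sup>2 * d) \<in> I"
      using insert.prems(3) insert.hyps by (simp add: mult_ac)
  qed (rule insert.prems(1), simp)
  \<comment> \<open>Up to the nonzero constant this difference is \<open>?c * d + 2 * e * d\<close>.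
    Times \<open>e\<close>, and modulo \<open>e\<^sup>2 * d\<close>, it gives \<open>e * d\<close>,
    and then \<open>d\<close>.\<close>
  then have "(e + ?c)\<^sup>2 * d - e\<^sup>2 * d \<in> I"
    by (rule poly_idealD(5)[OF I _ insert.prems(2)])
  then have 1: "?c * (?c * d + 2 * e * d) \<in> I"
    by (simp add: power2_eq_square algebra_simps)
  then have 2: "?c * d + 2 * e * d \<in> I" by (rule poly_ideal_cancel_const[OF I _ nz])
  then have "e * (?c * d + 2 * e * d) - 2 * (e\<^sup>2 * d) \<in> I"
    by (intro poly_idealD(5,3)[OF I] insert.prems)
  then have "?c * (e * d) \<in> I" by (simp add: power2_eq_square algebra_simps)
  then have "e * d \<in> I" by (rule poly_ideal_cancel_const[OF I _ nz])
  from poly_idealD(5)[OF I 2 poly_idealD(3)[OF I this]]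
  have "?c * d + 2 * e * d - 2 * (e * d) \<in> I" .
  then have "?c * d \<in> I" by (simp add: algebra_simps)
  then show ?case by (rule poly_ideal_cancel_const[OF I _ nz])
qed simp

text \<open>The products omitting one index have no common root in \<open>L\<close>, so they
  generate the unit ideal. The induction hypothesis for \<open>F\<close> is applied to
  \<open>(L - PConst (\<tau> x))\<^sup>2 * d\<close>; that square and the product over
  \<open>F\<close> are then coprime.\<close>

lemma mem_ideal_if_complementary_squares:
  assumes I: "poly_ideal I" and "finite Z" "Z \<noteq> {}" and "inj_on \<tau> Z"
    and "\<And>y. y \<in> Z \<Longrightarrow> (\<Prod>w\<in>Z - {y}. (L - PConst (\<tau> w))\<^sup>2) * d \<in> I"
  shows "d \<in> I"
  using assms(2-)
proof (induction Z arbitrary: d rule: finite_ne_induct)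
  case (singleton x)
  from singleton(2)[of x] show ?case by simp
next
  case (insert x F)
  have 1: "(L - PConst (\<tau> x))\<^sup>2 * d \<in> I"
  proof (rule insert.IH)
    fix y assume y: "y \<in> F"
    then have eq: "insert x F - {y} = insert x (F - {y})" using insert.hyps by auto
    have "(\<Prod>w\<in>F - {y}. (L - PConst (\<tau> w))\<^sup>2) * ((L - PConst (\<tau> x))\<^sup>2 * d) =
        (\<Prod>w\<in>insert x F - {y}. (L - PConst (\<tau> w))\<^sup>2) * d"
      unfolding eq using insert.hyps by (subst prod.insert) (auto simp: mult_ac)
    then show "(\<Prod>w\<in>F - {y}. (L - PConst (\<tau> w))\<^sup>2) * ((L - PConst (\<tau> x))\<^sup>2 * d) \<in> I"
      using insert.prems(2)[of y] y by (metis insertI2)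
  qed (rule inj_on_subset[OF insert.prems(1)], auto)
  have "insert x F - {x} = F" using insert.hyps by auto
  then have "(\<Prod>w\<in>F. (L - PConst (\<tau> w))\<^sup>2) * d \<in> I" using insert.prems(2)[of x] by (metis insertI1)
  then have 2: "(\<Prod>w\<in>F. ((L - PConst (\<tau> x)) + PConst (\<tau> x - \<tau> w))\<^sup>2) * d \<in> I"
    by (simp add: PConst_diff)
  show ?case
  proof (rule mem_ideal_if_coprime_squares[OF I insert.hyps(1) _ 1 2])
    show "\<tau> x - \<tau> w \<noteq> 0" if "w \<in> F" for w
      using insert.prems(1) insert.hyps that by (auto simp: inj_on_def)
  qed
qed

text \<open>Lagrange interpolation of an injective labelling of the points.\<close>

lemma separating_polynomial:
  fixes Z :: "('v::finite \<Rightarrow> real) set"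
  assumes "finite Z"
  obtains L where "inj_on (eval L) Z"
proof -
  obtain k :: "('v \<Rightarrow> real) \<Rightarrow> nat" where k: "inj_on k Z"
    using finite_imp_inj_to_nat_seg[OF assms] by metis
  have "\<exists>v. y \<noteq> w \<longrightarrow> y v \<noteq> w v" for y w :: "'v \<Rightarrow> real" by auto
  then obtain s where s: "\<And>y w :: 'v \<Rightarrow> real. y \<noteq> w \<Longrightarrow> y (s y w) \<noteq> w (s y w)" by metis
  \<comment> \<open>An unnormalised Lagrange basis polynomial: the factor for \<open>w\<close> uses
    a coordinate in which \<open>y\<close> and \<open>w\<close> differ.\<close>
  define e where "e y = (\<Prod>w\<in>Z - {y}. PVar (s y w) - PConst (w (s y w)))" for y
  define L where "L = (\<Sum>y\<in>Z. PConst (real (k y) / eval (e y) y) * e y)"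
  have e1: "eval (e y) y \<noteq> 0" for y
    using assms s[of y] by (auto simp: e_def)
  have e0: "eval (e y) z = 0" if "z \<in> Z" "z \<noteq> y" for y z
    using assms that by (auto simp: e_def intro!: bexI[of _ z])
  have "eval L z = k z" if "z \<in> Z" for z
  proof -
    have "eval L z = (\<Sum>y\<in>Z. if y = z then real (k z) else 0)"
      unfolding L_def eval_sum using e0[OF that] e1 by (intro sum.cong) auto
    then show ?thesis using assms that by simp
  qed
  then have "inj_on (eval L) Z" using k by (auto simp: inj_on_def)
  then show thesis by (rule that)
qed

section \<open>Polynomials bounded by an order unit\<close>

text \<open>For \<open>u = 1\<close>, that this is the whole ring is the Archimedean property of
  \<open>C\<close>.\<close>

definition order_span :: "'v rpoly set \<Rightarrow> 'v rpoly \<Rightarrow> 'v rpoly set" where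
  "order_span C u = {h. \<exists>N. PConst N * u - h \<in> C \<and> PConst N * u + h \<in> C}"

lemma order_span_nonneg:
  assumes C: "sos_cone C" "u \<in> C" and "h \<in> order_span C u"
  obtains N where "N \<ge> 0" "PConst N * u - h \<in> C" "PConst N * u + h \<in> C"
proof -
  obtain N where N: "PConst N * u - h \<in> C" "PConst N * u + h \<in> C"
    using assms by (auto simp: order_span_def)
  have "PConst (\<bar>N\<bar> - N) * u \<in> C" by (intro sos_cone_scale[OF C]) auto
  from sos_cone_add[OF C(1) N(1) this] sos_cone_add[OF C(1) N(2) this]
  show thesis by (intro that[of "\<bar>N\<bar>"]) (auto simp: PConst_diff algebra_simps)
qed

lemma order_span_0: "sos_cone C \<Longrightarrow> 0 \<in> order_span C u"
  by (auto simp: order_span_def intro!: exI[of _ 0] sos_cone_zero)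

lemma order_span_add:
  assumes C: "sos_cone C" and "p \<in> order_span C u" "q \<in> order_span C u"
  shows "p + q \<in> order_span C u"
proof -
  obtain N where N: "PConst N * u - p \<in> C" "PConst N * u + p \<in> C"
    using assms by (auto simp: order_span_def)
  obtain K where K: "PConst K * u - q \<in> C" "PConst K * u + q \<in> C"
    using assms by (auto simp: order_span_def)
  from sos_cone_add[OF C N(1) K(1)] sos_cone_add[OF C N(2) K(2)] show ?thesis
    by (auto simp: order_span_def PConst_add algebra_simps intro!: exI[of _ "N + K"])
qed

lemma order_span_minus: "p \<in> order_span C u \<Longrightarrow> - p \<in> order_span C u"
  by (auto simp: order_span_def)

lemma order_span_diff: "sos_cone C \<Longrightarrow> p \<in> order_span C u \<Longrightarrow> q \<in> order_span C u \<Longrightarrow> p - q \<in> order_span C u"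
  using order_span_add[of C p u "- q"] order_span_minus[of q C u] by simp

lemma order_span_scale_pos:
  assumes C: "sos_cone C" and "c \<ge> 0" and "p \<in> order_span C u"
  shows "PConst c * p \<in> order_span C u"
proof -
  obtain N where N: "PConst N * u - p \<in> C" "PConst N * u + p \<in> C"
    using assms by (auto simp: order_span_def)
  from sos_cone_scale[OF C N(1) assms(2)] sos_cone_scale[OF C N(2) assms(2)] show ?thesis
    by (auto simp: order_span_def PConst_mult algebra_simps intro!: exI[of _ "c * N"])
qed

lemma order_span_scale:
  assumes "sos_cone C" and "p \<in> order_span C u"
  shows "PConst c * p \<in> order_span C u"
proof (cases "c \<ge> 0")
  case False
  then have "PConst (- c) * p \<in> order_span C u"
    using assms by (intro order_span_scale_pos) auto
  from order_span_minus[OF this] show ?thesis by (simp add: PConst_minus)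
qed (use assms order_span_scale_pos in blast)

lemma order_span_unit: "sos_cone C \<Longrightarrow> u \<in> C \<Longrightarrow> u \<in> order_span C u"
  by (auto simp: order_span_def intro!: exI[of _ 1] sos_cone_zero sos_cone_add)

lemma order_span_dominated:
  assumes C: "sos_cone C" and w: "w \<in> order_span C u"
    and p: "PConst N * w - p \<in> C" "PConst N * w + p \<in> C"
  shows "p \<in> order_span C u"
proof -
  obtain K where K: "PConst K * u - PConst N * w \<in> C"
    using order_span_scale[OF C w, of N] by (auto simp: order_span_def)
  from sos_cone_add[OF C K p(1)] sos_cone_add[OF C K p(2)] show ?thesis
    by (auto simp: order_span_def)
qed

text \<open>Multiplying the bounds on \<open>h\<close> by \<open>b\<^sup>2\<close> bounds
  \<open>b\<^sup>2 * h\<close> by \<open>b\<^sup>2 * u\<close>, so control of \<open>u\<close> alone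
  suffices for square multipliers; polarisation reaches the others.\<close>

lemma order_span_ideal:
  assumes C: "sos_cone C" and u: "u \<in> C" and sq: "\<And>b. b\<^sup>2 * u \<in> order_span C u"
  shows "poly_ideal (order_span C u)"
  unfolding poly_ideal_def
proof (intro conjI ballI allI order_span_0[OF C] order_span_add[OF C])
  fix a h assume h: "h \<in> order_span C u"
  have sqh: "b\<^sup>2 * h \<in> order_span C u" for b
  proof -
    obtain N where N: "PConst N * u - h \<in> C" "PConst N * u + h \<in> C"
      using h by (auto simp: order_span_def)
    from sos_cone_square[OF C N(1), of b] sos_cone_square[OF C N(2), of b] show ?thesis
      by (intro order_span_dominated[OF C sq[of b], of N]) (auto simp: algebra_simps)
  qed
  have "a * h = PConst (1/4) * ((a + 1)\<^sup>2 * h) - PConst (1/4) * ((a - 1)\<^sup>2 * h)"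
    by (subst quarter_square_diff[of a]) (simp add: algebra_simps)
  then show "a * h \<in> order_span C u"
    by (simp add: order_span_diff[OF C] order_span_scale[OF C] sqh)
qed auto

text \<open>By polarisation it is enough to bound squares. As cones need not be closed under
  products, the bound on \<open>r\<^sup>2\<close> comes from writing
  \<open>2 * K * (K\<^sup>2 - r\<^sup>2)\<close> as
  \<open>(K + r)\<^sup>2 * (K - r) + (K - r)\<^sup>2 * (K + r)\<close>, which multiplies by squares
  only.\<close>

lemma order_span_one_mult:
  assumes C: "sos_cone C" and one: "1 \<in> C" and pq: "p \<in> order_span C 1" "q \<in> order_span C 1"
  shows "p * q \<in> order_span C 1"
proof -
  have sq: "r\<^sup>2 \<in> order_span C 1" if r: "r \<in> order_span C 1" for r
  proof -
    obtain N where N: "N \<ge> 0" "PConst N * 1 - r \<in> C" "PConst N * 1 + r \<in> C"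
      using order_span_nonneg[OF C one r] by blast
    \<comment> \<open>Passing to \<open>N + 1\<close> makes the bound positive, so that
      \<open>2 * (N + 1)\<close> can be divided out.\<close>
    have N1: "PConst (N + 1) - r \<in> C" "PConst (N + 1) + r \<in> C"
      using sos_cone_add[OF C N(2) one] sos_cone_add[OF C N(3) one] by (auto simp: PConst_add algebra_simps)
    let ?K = "PConst (N + 1)"
    have "PConst (1 / (2 * (N + 1))) * ((?K + r)\<^sup>2 * (?K - r) + (?K - r)\<^sup>2 * (?K + r)) \<in> C"
      using N(1) by (intro sos_cone_scale[OF C] sos_cone_add[OF C] sos_cone_square[OF C] N1) auto
    moreover have "(?K + r)\<^sup>2 * (?K - r) + (?K - r)\<^sup>2 * (?K + r) = PConst (2 * (N + 1)) * (?K\<^sup>2 - r\<^sup>2)"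
      unfolding PConst_mult by (simp add: power2_eq_square algebra_simps)
    moreover have "PConst (1 / (2 * (N + 1))) * (PConst (2 * (N + 1)) * (?K\<^sup>2 - r\<^sup>2)) = ?K\<^sup>2 - r\<^sup>2"
      using N(1) by (simp flip: mult.assoc PConst_mult)
    ultimately have "PConst ((N + 1)\<^sup>2) * 1 - r\<^sup>2 \<in> C" by (simp add: PConst_power)
    moreover have "PConst ((N + 1)\<^sup>2) * 1 + r\<^sup>2 * 1 \<in> C"
      by (intro sos_cone_add[OF C] sos_cone_scale[OF C one] sos_cone_square[OF C one]) auto
    ultimately show ?thesis unfolding order_span_def by auto
  qed
  have "p * q = PConst (1/4) * (p + q)\<^sup>2 - PConst (1/4) * (p - q)\<^sup>2"
  proof -
    have "PConst (1/4) * (p + q)\<^sup>2 - PConst (1/4) * (p - q)\<^sup>2 = PConst (1/4) * PConst 4 * (p * q)"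
      by (simp add: power2_eq_square algebra_simps)
    also have "\<dots> = p * q"
      by (simp flip: PConst_mult del: PConst_numeral)
    finally show ?thesis by simp
  qed
  then show ?thesis
    by (simp add: order_span_diff[OF C] order_span_scale[OF C] order_span_add[OF C] sq pq)
qed

text \<open>Bounded polynomials form a ring containing the constants, so bounding the generators is
  enough.\<close>

lemma archimedean_if_variables_bounded:
  assumes C: "sos_cone C" and one: "1 \<in> C" and var: "\<And>v. PVar v \<in> order_span C 1"
  shows "p \<in> order_span C 1"
proof (induction p rule: rpoly_induct)
  case (const c)
  show ?case
    using order_span_scale[OF C order_span_unit[OF C one], of c] by simp
qed (auto intro: var order_span_add[OF C] order_span_one_mult[OF C one])

section \<open>Quadratic modules and finitely many linear zeros\<close>

lemma quadratic_module_cone: "sos_cone (quadratic_module g)"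
  unfolding sos_cone_def
proof (intro conjI ballI allI)
  show "0 \<in> quadratic_module g"
    unfolding quadratic_module_def
    by (rule CollectI, rule exI[of _ 0], rule exI[of _ "\<lambda>_. 0"]) (simp add: zero_in_sos)
next
  fix p q assume "p \<in> quadratic_module g" "q \<in> quadratic_module g"
  then obtain s0 s t0 t where *: "p = s0 + (\<Sum>i\<in>UNIV. s i * g i)" "q = t0 + (\<Sum>i\<in>UNIV. t i * g i)"
    "s0 \<in> sos" "t0 \<in> sos" "\<And>i. s i \<in> sos" "\<And>i. t i \<in> sos"
    by (auto simp: quadratic_module_def)
  then have "p + q = (s0 + t0) + (\<Sum>i\<in>UNIV. (s i + t i) * g i)"
    by (simp add: distrib_right sum.distrib)
  then show "p + q \<in> quadratic_module g"
    unfolding quadratic_module_def using *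
    by (intro CollectI exI[of _ "s0 + t0"] exI[of _ "\<lambda>i. s i + t i"]) (auto intro: sos_add)
next
  fix p q assume "q \<in> quadratic_module g"
  then obtain t0 t where *: "q = t0 + (\<Sum>i\<in>UNIV. t i * g i)" "t0 \<in> sos" "\<And>i. t i \<in> sos"
    by (auto simp: quadratic_module_def)
  then have "p\<^sup>2 * q = p\<^sup>2 * t0 + (\<Sum>i\<in>UNIV. (p\<^sup>2 * t i) * g i)"
    by (simp add: distrib_left sum_distrib_left mult.assoc)
  then show "p\<^sup>2 * q \<in> quadratic_module g"
    unfolding quadratic_module_def using *
    by (intro CollectI exI[of _ "p\<^sup>2 * t0"] exI[of _ "\<lambda>i. p\<^sup>2 * t i"])
       (auto intro: sos_mult square_in_sos)
qed

lemma sos_subset_quadratic_module: "s \<in> sos \<Longrightarrow> s \<in> quadratic_module g"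
  unfolding quadratic_module_def
  by (rule CollectI, rule exI[of _ s], rule exI[of _ "\<lambda>_. 0"]) (simp add: zero_in_sos)

lemma generator_in_quadratic_module: "g c \<in> quadratic_module g"
proof -
  have "g c = 0 + (\<Sum>i\<in>UNIV. (if i = c then 1 else 0) * g i)"
    by (simp add: if_distrib[of "\<lambda>x. x * _"] cong: if_cong)
  then show ?thesis
    unfolding quadratic_module_def
    by (intro CollectI exI[of _ 0] exI[of _ "\<lambda>i. if i = c then 1 else 0"])
       (auto simp: zero_in_sos one_in_sos)
qed

text \<open>The generators active at a zero bound \<open>f\<close> from below linearly there; this replaces the boundary
  Hessian condition. The squares \<open>s y\<close> localise at \<open>y \<in> Z\<close> and generate the unit ideal, so it
  suffices to bound each \<open>s y * f\<close> by the order unit \<open>u\<close>.\<close>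

theorem quadratic_module_member_if_linear_zeros:
  fixes g :: "'c::finite \<Rightarrow> 'v::finite rpoly" and Z :: "('v \<Rightarrow> real) set"
  assumes arch: "\<And>p. p \<in> order_span (quadratic_module g) 1"
    and Z: "finite Z" "Z \<noteq> {}"
    and pos: "\<And>y. (\<And>c. 0 \<le> eval (g c) y) \<Longrightarrow> y \<notin> Z \<Longrightarrow> 0 < eval f y"
    and lin: "\<And>y v. y \<in> Z \<Longrightarrow>
      \<exists>\<beta>. PVar v - PConst (y v) = (\<Sum>c | eval (g c) y = 0. PConst (\<beta> c) * g c)"
    and zero: "\<And>y. y \<in> Z \<Longrightarrow> \<exists>\<alpha> q. (\<forall>c. 0 < \<alpha> c) \<and> (\<forall>v. eval (q v) y = 0) \<and>
      f = (\<Sum>c | eval (g c) y = 0. PConst (\<alpha> c) * g c) + (\<Sum>v\<in>UNIV. (PVar v - PConst (y v)) * q v)"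
  shows "f \<in> quadratic_module g"
proof -
  let ?M = "quadratic_module g"
  note M = quadratic_module_cone[of g]
  have sosM: "s \<in> ?M" if "s \<in> sos" for s using that by (rule sos_subset_quadratic_module)
  obtain L where L: "inj_on (eval L) Z" using separating_polynomial[OF Z(1)] .
  \<comment> \<open>For \<open>y \<in> Z\<close> this vanishes on \<open>Z\<close> except at
    \<open>y\<close>, where it is nonzero because \<open>L\<close> separates.\<close>
  define r where "r y = (\<Prod>w\<in>Z - {y}. L - PConst (eval L w))" for y
  define s where "s y = (r y)\<^sup>2" for y
  define t where "t y v = PVar v - PConst (y v)" for y :: "'v \<Rightarrow> real" and v
  define act where "act y = {c. eval (g c) y = 0}" for y
  have s_prod: "s y = (\<Prod>w\<in>Z - {y}. (L - PConst (eval L w))\<^sup>2)" for y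
    by (simp add: s_def r_def prod_power_distrib)
  have s_sos: "s y \<in> sos" for y by (simp add: s_def square_in_sos)
  \<comment> \<open>The order unit collects, around each \<open>y\<close>, localised squares of the
    coordinates and localised active generators. All summands lie in the module, hence each is
    bounded by \<open>u\<close>, and all vanish on \<open>Z\<close>.\<close>
  define S where "S y = (\<Sum>v\<in>UNIV. s y * (t y v)\<^sup>2) + (\<Sum>c\<in>act y. s y * g c)" for y
  define u where "u = (\<Sum>y\<in>Z. S y)"
  have e1: "s y * (t y v)\<^sup>2 \<in> ?M" for y v by (intro sosM sos_mult s_sos square_in_sos)
  have e2: "s y * g c \<in> ?M" for y c by (intro sos_cone_sos[OF M generator_in_quadratic_module] s_sos)
  have SM: "S y \<in> ?M" for y unfolding S_def by (intro sos_cone_add[OF M] sos_cone_sum[OF M] e1 e2)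
  have uM: "u \<in> ?M" unfolding u_def by (intro sos_cone_sum[OF M] SM)
  let ?O = "order_span ?M u"
  have span_if: "p \<in> ?O" if "p \<in> ?M" "u - p \<in> ?M" for p
    using that sos_cone_add[OF M uM that(1)] unfolding order_span_def by (intro CollectI exI[of _ 1]) auto
  have uS: "u - S y \<in> ?M" if "y \<in> Z" for y
    using Z(1) that by (simp add: u_def sum.remove[of Z y] sos_cone_sum[OF M SM])
  have O1: "s y * (t y v)\<^sup>2 \<in> ?O" if "y \<in> Z" for y v
  proof (rule span_if[OF e1])
    have "S y - s y * (t y v)\<^sup>2 = (\<Sum>w\<in>UNIV - {v}. s y * (t y w)\<^sup>2) + (\<Sum>c\<in>act y. s y * g c)"
      by (simp add: S_def sum.remove[of UNIV v])
    also have "\<dots> \<in> ?M" by (intro sos_cone_add[OF M] sos_cone_sum[OF M] e1 e2)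
    finally show "u - s y * (t y v)\<^sup>2 \<in> ?M" using sos_cone_add[OF M uS[OF that]] by fastforce
  qed
  have O2: "s y * g c \<in> ?O" if "y \<in> Z" "c \<in> act y" for y c
  proof (rule span_if[OF e2])
    have "S y - s y * g c = (\<Sum>v\<in>UNIV. s y * (t y v)\<^sup>2) + (\<Sum>d\<in>act y - {c}. s y * g d)"
      using that by (simp add: S_def sum.remove[of "act y" c])
    also have "\<dots> \<in> ?M" by (intro sos_cone_add[OF M] sos_cone_sum[OF M] e1 e2)
    finally show "u - s y * g c \<in> ?M" using sos_cone_add[OF M uS[OF that(1)]] by fastforce
  qed
  \<comment> \<open>The Archimedean bound on \<open>a\<close>, multiplied by the square
    \<open>(r y * p)\<^sup>2\<close>.\<close>
  have O3: "a * (s y * p\<^sup>2) \<in> ?O" if "s y * p\<^sup>2 \<in> ?O" for a p y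
  proof -
    obtain N where N: "PConst N * 1 - a \<in> ?M" "PConst N * 1 + a \<in> ?M"
      using arch[of a] by (auto simp: order_span_def)
    show ?thesis
      by (rule order_span_dominated[OF M that, of N])
         (use sos_cone_square[OF M N(1), of "r y * p"] sos_cone_square[OF M N(2), of "r y * p"]
          in \<open>auto simp: s_def algebra_simps power_mult_distrib\<close>)
  qed
  have sq: "s y * p\<^sup>2 \<in> ?O" if y: "y \<in> Z" and p: "eval p y = 0" for y p
  proof -
    \<comment> \<open>Closure under addition is
      \<open>(p + q)\<^sup>2 \<le> 2 * (p\<^sup>2 + q\<^sup>2)\<close> in the order of the module;
      the coordinates around \<open>y\<close> belong by \<open>O1\<close>.\<close>
    have "poly_ideal {p. s y * p\<^sup>2 \<in> ?O}"
      unfolding poly_ideal_def mem_Collect_eq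
    proof (intro conjI ballI allI; (unfold mem_Collect_eq)?)
      show "s y * 0\<^sup>2 \<in> ?O" by (simp add: order_span_0[OF M])
    next
      fix p q assume pq: "s y * p\<^sup>2 \<in> ?O" "s y * q\<^sup>2 \<in> ?O"
      show "s y * (p + q)\<^sup>2 \<in> ?O"
      proof -
        have "PConst 2 * (s y * p\<^sup>2 + s y * q\<^sup>2) - s y * (p + q)\<^sup>2 = s y * (p - q)\<^sup>2"
          by (simp add: power2_eq_square algebra_simps)
        then have 1: "PConst 2 * (s y * p\<^sup>2 + s y * q\<^sup>2) - s y * (p + q)\<^sup>2 \<in> ?M"
          by (simp add: sosM sos_mult s_sos square_in_sos)
        have 2: "PConst 2 * (s y * p\<^sup>2 + s y * q\<^sup>2) + s y * (p + q)\<^sup>2 \<in> ?M"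
          by (intro sosM sos_add sos_mult s_sos square_in_sos PConst_in_sos) simp
        have "s y * p\<^sup>2 + s y * q\<^sup>2 \<in> ?O" using pq by (auto intro: order_span_add[OF M])
        from order_span_dominated[OF M this 1 2] show ?thesis .
      qed
    next
      fix a q assume "s y * q\<^sup>2 \<in> ?O"
      then show "s y * (a * q)\<^sup>2 \<in> ?O"
        using O3[of y q "a\<^sup>2"] by (simp add: power_mult_distrib mult.left_commute)
    qed
    from vanishing_mem_ideal[OF this, of y p] O1[OF y] p show ?thesis
      by (simp add: t_def)
  qed
  have prod: "s y * (p * q) \<in> ?O" if y: "y \<in> Z" and pq: "eval p y = 0" "eval q y = 0" for y p q
  proof -
    have "s y * (p * q) = PConst (1/2) * PConst 2 * (s y * (p * q))"
      by (simp flip: PConst_mult del: PConst_numeral)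
    also have "\<dots> = PConst (1/2) * (s y * (p + q)\<^sup>2 - s y * p\<^sup>2 - s y * q\<^sup>2)"
      by (simp add: power2_eq_square algebra_simps)
    also have "\<dots> \<in> ?O"
      by (intro order_span_scale[OF M] order_span_diff[OF M] sq[OF y]) (use pq in auto)
    finally show ?thesis .
  qed
  have tz: "eval (t y v) y = 0" for y v by (simp add: t_def)
  have O_sum: "(\<Sum>i\<in>A. p i) \<in> ?O" if "\<And>i. i \<in> A \<Longrightarrow> p i \<in> ?O" for p :: "'x \<Rightarrow> 'v rpoly" and A
    using that by (induction A rule: infinite_finite_induct) (auto intro: order_span_0[OF M] order_span_add[OF M])
  have bu: "b\<^sup>2 * u \<in> ?O" for b
  proof -
    have 1: "b\<^sup>2 * (s y * (t y v)\<^sup>2) \<in> ?O" if "y \<in> Z" for y v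
      using O3[OF O1[OF that]] .
    \<comment> \<open>Splitting off the value of \<open>b\<^sup>2\<close> at \<open>y\<close> leaves
      a product of two polynomials vanishing at \<open>y\<close>, which \<open>prod\<close>
      handles.\<close>
    have 2: "b\<^sup>2 * (s y * g c) \<in> ?O" if "y \<in> Z" "c \<in> act y" for y c
    proof -
      have "b\<^sup>2 * (s y * g c) = s y * ((b\<^sup>2 - PConst ((eval b y)\<^sup>2)) * g c) + PConst ((eval b y)\<^sup>2) * (s y * g c)"
        by (simp add: algebra_simps)
      also have "\<dots> \<in> ?O"
        using that by (intro order_span_add[OF M] order_span_scale[OF M] prod O2) (auto simp: act_def)
      finally show ?thesis .
    qed
    have "b\<^sup>2 * S y \<in> ?O" if "y \<in> Z" for y
      unfolding S_def distrib_left sum_distrib_left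
      by (intro order_span_add[OF M] O_sum 1 2 that)
    then have "(\<Sum>y\<in>Z. b\<^sup>2 * S y) \<in> ?O" by (rule O_sum)
    then show ?thesis
      by (simp add: u_def sum_distrib_left)
  qed
  note OI = order_span_ideal[OF M uM bu]
  \<comment> \<open>Vanishing to first order is enough now: by \<open>lin\<close> the coordinates
    around \<open>y\<close> are combinations of active generators, which \<open>O2\<close>
    bounds.\<close>
  have sv: "s y * p \<in> ?O" if y: "y \<in> Z" and p: "eval p y = 0" for y p
  proof -
    have "poly_ideal {p. s y * p \<in> ?O}"
      using poly_idealD[OF OI] by (auto simp: poly_ideal_def distrib_left mult.left_commute)
    moreover have "s y * t y v \<in> ?O" for v
    proof -
      obtain \<beta> where "t y v = (\<Sum>c\<in>act y. PConst (\<beta> c) * g c)"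
        using lin[OF y, of v] by (auto simp: t_def act_def)
      then have "s y * t y v = (\<Sum>c\<in>act y. PConst (\<beta> c) * (s y * g c))"
        by (simp add: sum_distrib_left mult.left_commute)
      then show ?thesis by (simp add: O_sum order_span_scale[OF M] O2 y)
    qed
    ultimately show ?thesis using vanishing_mem_ideal[of "{p. s y * p \<in> ?O}" y p] p by (simp add: t_def)
  qed
  have fz: "eval f y = 0" if y: "y \<in> Z" for y
  proof -
    obtain \<alpha> q where f: "f = (\<Sum>c | eval (g c) y = 0. PConst (\<alpha> c) * g c) + (\<Sum>v\<in>UNIV. (PVar v - PConst (y v)) * q v)"
      using zero[OF y] by blast
    show ?thesis by (subst f) simp
  qed
  \<comment> \<open>\<open>f\<close> vanishes on \<open>Z\<close>, so every \<open>s y * f\<close>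
    is in the span, and the \<open>s y\<close> generate the unit ideal.\<close>
  have fO: "f \<in> ?O"
    by (rule mem_ideal_if_complementary_squares[OF OI Z L, of L])
       (use sv fz in \<open>simp flip: s_prod\<close>)
  \<comment> \<open>Inside the ideal \<open>?O\<close> the polynomial \<open>u\<close> is an order
    unit, so the state criterion applies to \<open>?C\<close> and \<open>?O\<close>.\<close>
  let ?C = "?M \<inter> ?O"
  have C: "sos_cone ?C"
    unfolding sos_cone_def using poly_idealD[OF OI] sos_cone_zero[OF M] sos_cone_add[OF M] sos_cone_square[OF M]
    by auto
  have uO: "u \<in> ?O" by (rule order_span_unit[OF M uM])
  have unit: "order_unit ?C u ?O"
    unfolding order_unit_def
  proof (intro conjI ballI)
    show "u \<in> ?C" using uM uO by blast
    fix h assume h: "h \<in> ?O"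
    then obtain N where "PConst N * u - h \<in> ?M" by (auto simp: order_span_def)
    moreover have "PConst N * u - h \<in> ?O" using h uO poly_idealD[OF OI] by blast
    ultimately show "\<exists>N. PConst N * u - h \<in> ?C" by blast
  qed
  have uz: "eval u z = 0" if "z \<in> Z" for z
  proof -
    have "eval (S y) z = 0" if y: "y \<in> Z" for y
    proof (cases "y = z")
      case False
      then have "eval (s y) z = 0"
        using Z(1) \<open>z \<in> Z\<close> by (auto simp: s_prod intro!: bexI[of _ z])
      then show ?thesis by (simp add: S_def)
    qed (simp add: S_def tz act_def)
    then show ?thesis by (simp add: u_def)
  qed
  have "f \<in> ?C"
  proof (rule mem_cone_if_states_positive[OF C OI _ unit fO])
    fix \<phi> z
    assume add: "\<And>p q. p \<in> ?O \<Longrightarrow> q \<in> ?O \<Longrightarrow> \<phi> (p + q) = \<phi> p + \<phi> q"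
      and mult: "\<And>a h. h \<in> ?O \<Longrightarrow> \<phi> (a * h) = eval a z * \<phi> h"
      and nonneg: "\<And>h. h \<in> ?C \<Longrightarrow> 0 \<le> \<phi> h" and one: "\<phi> u = (1 :: real)"
    have phi0: "\<phi> 0 = 0" using mult[OF uO, of 0] by simp
    have phi_sum: "\<phi> (\<Sum>i\<in>A. p i) = (\<Sum>i\<in>A. \<phi> (p i))"
      if "\<And>i. i \<in> A \<Longrightarrow> p i \<in> ?O" for p :: "'x \<Rightarrow> 'v rpoly" and A
      using that by (induction A rule: infinite_finite_induct) (auto simp: phi0 add O_sum)
    \<comment> \<open>At most one factor \<open>L - PConst (eval L w)\<close> can vanish at
      \<open>z\<close>; the \<open>s y\<close> omitting it is nonzero there.\<close>
    have "\<exists>y\<in>Z. eval (s y) z \<noteq> 0"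
    proof (cases "\<exists>y\<in>Z. eval L z = eval L y")
      case True
      then obtain y where y: "y \<in> Z" "eval L z = eval L y" by blast
      then have "eval (s y) z \<noteq> 0"
        using Z(1) L by (auto simp: s_prod inj_on_def)
      then show ?thesis using y by blast
    next
      case False
      then have "eval (s y) z \<noteq> 0" for y using Z(1) by (auto simp: s_prod)
      then show ?thesis using Z(2) by blast
    qed
    then obtain y where y: "y \<in> Z" and sy: "eval (s y) z \<noteq> 0" by blast
    have sy0: "eval (s y) z > 0" using sy by (simp add: s_def)
    show "0 < \<phi> f"
    proof (cases "z = y")
      case True
      have ev: "eval p y * \<phi> h = \<phi> (p * h)" if "h \<in> ?O" for p h
        using mult[OF that] True by simp
      obtain \<alpha> q where \<alpha>: "\<And>c. 0 < \<alpha> c" and q: "\<And>v. eval (q v) y = 0"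
        and f: "f = (\<Sum>c\<in>act y. PConst (\<alpha> c) * g c) + (\<Sum>v\<in>UNIV. t y v * q v)"
        using zero[OF y] unfolding t_def act_def by blast
      have g0: "0 \<le> \<phi> (s y * g c)" if "c \<in> act y" for c
        using nonneg e2 O2[OF y that] by blast
      have scale: "\<phi> (PConst c * h) = c * \<phi> h" if "h \<in> ?O" for c h
        using mult[OF that] by simp
      have "eval (s y) y * \<phi> f = \<phi> (s y * f)" by (rule ev[OF fO])
      also have "s y * f = (\<Sum>c\<in>act y. PConst (\<alpha> c) * (s y * g c)) + (\<Sum>v\<in>UNIV. t y v * (s y * q v))"
        by (subst f) (simp add: distrib_left sum_distrib_left mult.left_commute)
      also have "\<phi> \<dots> = (\<Sum>c\<in>act y. \<alpha> c * \<phi> (s y * g c)) + (\<Sum>v\<in>UNIV. \<phi> (t y v * (s y * q v)))"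
      proof -
        have 1: "PConst (\<alpha> c) * (s y * g c) \<in> ?O" if "c \<in> act y" for c
          by (rule order_span_scale[OF M O2[OF y that]])
        have 2: "t y v * (s y * q v) \<in> ?O" for v
          by (rule poly_idealD(3)[OF OI sv[OF y q]])
        have "\<phi> (\<Sum>c\<in>act y. PConst (\<alpha> c) * (s y * g c)) = (\<Sum>c\<in>act y. \<alpha> c * \<phi> (s y * g c))"
          using 1 by (simp add: phi_sum scale O2 y)
        then show ?thesis
          using 2 by (simp add: phi_sum add O_sum 1)
      qed
      \<comment> \<open>Second order terms die: \<open>\<phi>\<close> pulls out the factor
        \<open>t y v\<close> as its value 0 at \<open>y\<close>.\<close>
      also have "(\<Sum>v\<in>UNIV. \<phi> (t y v * (s y * q v))) = 0"
        by (intro sum.neutral ballI) (simp add: tz sv y q flip: ev)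
      finally have eq: "eval (s y) y * \<phi> f = (\<Sum>c\<in>act y. \<alpha> c * \<phi> (s y * g c))" by simp
      \<comment> \<open>If \<open>\<phi>\<close> killed all localised active generators, it would
        kill \<open>s y * p\<close> for every \<open>p\<close> vanishing at \<open>y\<close>, in
        particular \<open>s y * u\<close>, although
        \<open>\<phi> (s y * u) = eval (s y) y \<noteq> 0\<close>.\<close>
      have "\<exists>c\<in>act y. \<phi> (s y * g c) \<noteq> 0"
      proof (rule ccontr)
        assume "\<not> ?thesis"
        then have all0: "\<phi> (s y * g c) = 0" if "c \<in> act y" for c using that by blast
        have "poly_ideal {p. s y * p \<in> ?O \<and> \<phi> (s y * p) = 0}"
          using poly_idealD[OF OI] phi0 by (auto simp: poly_ideal_def distrib_left mult.left_commute add mult)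
        moreover have "\<phi> (s y * t y v) = 0" for v
        proof -
          obtain \<beta> where "t y v = (\<Sum>c\<in>act y. PConst (\<beta> c) * g c)"
            using lin[OF y, of v] by (auto simp: t_def act_def)
          then have "s y * t y v = (\<Sum>c\<in>act y. PConst (\<beta> c) * (s y * g c))"
            by (simp add: sum_distrib_left mult.left_commute)
          then show ?thesis by (simp add: phi_sum order_span_scale[OF M] O2 y scale all0)
        qed
        ultimately have "\<phi> (s y * u) = 0"
          using vanishing_mem_ideal[of "{p. s y * p \<in> ?O \<and> \<phi> (s y * p) = 0}" y u] uz[OF y] sv[OF y tz]
          by (simp add: t_def)
        then show False using ev[OF uO, of "s y"] one sy True by simp
      qed
      then obtain c where c: "c \<in> act y" "\<phi> (s y * g c) > 0"
        using g0 by force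
      have "(\<Sum>c\<in>act y. \<alpha> c * \<phi> (s y * g c)) > 0"
        by (rule sum_pos2[OF _ c(1)]) (use c g0 \<alpha> in \<open>auto intro!: mult_nonneg_nonneg less_imp_le[OF \<alpha>]\<close>)
      then show ?thesis using eq sy0 True by (metis zero_less_mult_pos)
    next
      case False
      then obtain v where v: "z v \<noteq> y v" by auto
      define h where "h = s y * (t y v)\<^sup>2"
      have hO: "h \<in> ?O" and hM: "h \<in> ?M" using O1[OF y] e1 by (auto simp: h_def)
      have hz: "eval h z > 0" using sy0 v by (simp add: h_def t_def)
      \<comment> \<open>Reading \<open>\<phi> (u * k)\<close> in both orders shows that
        \<open>\<phi>\<close> is proportional to evaluation at \<open>z\<close>; \<open>h\<close>
        shows that the factor is positive.\<close>
      have ratio: "eval u z * \<phi> k = eval k z" if "k \<in> ?O" for k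
        using mult[OF that, of u] mult[OF uO, of k] one by (simp add: mult.commute)
      have "\<phi> h \<ge> 0" using nonneg hO hM by blast
      then have u0: "eval u z > 0" and h0: "\<phi> h > 0"
        using ratio[OF hO] hz zero_less_mult_iff[of "eval u z" "\<phi> h"] by auto
      have "0 \<le> eval (g c) z" for c
      proof -
        \<comment> \<open>\<open>h\<close> is itself a square, so \<open>g c * h\<close> stays in
          the module and the sign of \<open>g c\<close> at \<open>z\<close> can be read off.\<close>
        have "g c * h = (r y * t y v)\<^sup>2 * g c" by (simp add: h_def s_def power_mult_distrib)
        then have "g c * h \<in> ?M" using sos_cone_square[OF M generator_in_quadratic_module] by metis
        then have "0 \<le> \<phi> (g c * h)" using nonneg poly_idealD(3)[OF OI hO] by blast
        then show ?thesis using mult[OF hO] h0 by (simp add: zero_le_mult_iff)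
      qed
      moreover have "z \<notin> Z" using uz u0 by force
      ultimately have "0 < eval f z" by (rule pos)
      then show ?thesis using ratio[OF fO] u0 by (metis zero_less_mult_pos)
    qed
  qed auto
  then show ?thesis by blast
qed

section \<open>Affine constraints\<close>

text \<open>A Farkas lemma with strictly positive coefficients. If \<open>v\<close> is outside the
  convex set \<open>K\<close>, a separating \<open>w\<close> has
  \<open>v \<bullet> w \<le> 0\<close>, seen by shrinking all coefficients, and
  \<open>0 \<le> n c \<bullet> w\<close>, seen by enlarging one; the assumption forbids
  this.\<close>

lemma positive_combination:
  fixes n :: "'c::finite \<Rightarrow> 'a::euclidean_space"
  assumes "\<And>w. w \<noteq> 0 \<Longrightarrow> (\<And>c. c \<in> I \<Longrightarrow> 0 \<le> n c \<bullet> w) \<Longrightarrow> 0 < v \<bullet> w"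
  obtains \<alpha> :: "'c \<Rightarrow> real" where "\<And>c. 0 < \<alpha> c" "v = (\<Sum>c\<in>I. \<alpha> c *\<^sub>R n c)"
proof -
  define K where "K = {(\<Sum>c\<in>I. \<alpha> c *\<^sub>R n c) | \<alpha>. \<forall>c. 0 < \<alpha> c}"
  have KI: "(\<Sum>c\<in>I. \<alpha> c *\<^sub>R n c) \<in> K" if "\<And>c. 0 < \<alpha> c" for \<alpha>
    using that by (auto simp: K_def)
  have "convex K"
  proof (rule convexI)
    fix x y and s t :: real
    assume "x \<in> K" "y \<in> K" and st: "0 \<le> s" "0 \<le> t" "s + t = 1"
    then obtain \<alpha> \<beta> where \<alpha>: "\<And>c. 0 < \<alpha> c" "x = (\<Sum>c\<in>I. \<alpha> c *\<^sub>R n c)"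
      and \<beta>: "\<And>c. 0 < \<beta> c" "y = (\<Sum>c\<in>I. \<beta> c *\<^sub>R n c)"
      by (auto simp: K_def)
    have "0 < s * \<alpha> c + t * \<beta> c" for c
      using \<alpha>(1)[of c] \<beta>(1)[of c] st by (cases "s = 0") (auto intro: add_pos_nonneg)
    moreover have "s *\<^sub>R x + t *\<^sub>R y = (\<Sum>c\<in>I. (s * \<alpha> c + t * \<beta> c) *\<^sub>R n c)"
      by (simp add: \<alpha> \<beta> scaleR_sum_right scaleR_add_left sum.distrib)
    ultimately show "s *\<^sub>R x + t *\<^sub>R y \<in> K" using KI[of "\<lambda>c. s * \<alpha> c + t * \<beta> c"] by simp
  qed
  have "v \<in> K"
  proof (rule ccontr)
    assume "v \<notin> K"
    moreover have "K \<noteq> {}" using KI[of "\<lambda>_. 1"] by auto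
    ultimately obtain w b where w: "w \<noteq> 0" "w \<bullet> v \<le> b" and wK: "\<And>k. k \<in> K \<Longrightarrow> b \<le> w \<bullet> k"
      using separating_hyperplane_sets[of "{v}" K] \<open>convex K\<close> by auto
    define S where "S = (\<Sum>c\<in>I. n c)"
    have le1: "w \<bullet> v \<le> e * (w \<bullet> S)" if "e > 0" for e
    proof -
      have "b \<le> w \<bullet> (\<Sum>c\<in>I. e *\<^sub>R n c)" by (intro wK KI that)
      then show ?thesis using w by (simp add: S_def flip: scaleR_sum_right)
    qed
    have "v \<bullet> w \<le> 0"
    proof (rule ccontr)
      assume *: "\<not> v \<bullet> w \<le> 0"
      \<comment> \<open>With these choices \<open>e * (w \<bullet> S)\<close> is at most half of
        \<open>w \<bullet> v\<close>; the summand 1 keeps \<open>B\<close> positive.\<close>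
      define B where "B = \<bar>w \<bullet> S\<bar> + 1"
      define e where "e = (w \<bullet> v) / (2 * B)"
      have B: "B > 0" unfolding B_def by linarith
      then have e: "e > 0" using * by (simp add: e_def inner_commute)
      have "e * (w \<bullet> S) \<le> e * B" using e by (intro mult_left_mono) (auto simp: B_def)
      also have "e * B = (w \<bullet> v) / 2" using B by (simp add: e_def)
      finally show False using le1[OF e] * by (simp add: inner_commute)
    qed
    moreover have "0 \<le> n c \<bullet> w" if c: "c \<in> I" for c
    proof (rule ccontr)
      assume *: "\<not> 0 \<le> n c \<bullet> w"
      have le2: "w \<bullet> v \<le> w \<bullet> S + l * (n c \<bullet> w)" if "l > 0" for l
      proof -
        have "b \<le> w \<bullet> (\<Sum>d\<in>I. (if d = c then 1 + l else 1) *\<^sub>R n d)" using that by (intro wK KI) auto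
        also have "(\<Sum>d\<in>I. (if d = c then 1 + l else 1) *\<^sub>R n d) = (\<Sum>d\<in>I. n d + (if d = c then l *\<^sub>R n d else 0))"
          by (intro sum.cong) (auto simp: scaleR_add_left)
        also have "\<dots> = S + l *\<^sub>R n c" using c by (simp add: S_def sum.distrib)
        finally show ?thesis using w by (simp add: inner_add_right inner_commute)
      qed
      \<comment> \<open>Large enough to push \<open>w \<bullet> S + l * (n c \<bullet> w)\<close>
        below \<open>w \<bullet> v\<close>.\<close>
      define l where "l = (\<bar>w \<bullet> S - w \<bullet> v\<bar> + 1) / - (n c \<bullet> w)"
      have "l > 0" using * unfolding l_def by (intro divide_pos_pos) linarith+
      moreover have "l * (n c \<bullet> w) = - (\<bar>w \<bullet> S - w \<bullet> v\<bar> + 1)" using * by (simp add: l_def)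
      ultimately show False using le2[of l] by linarith
    qed
    ultimately show False using assms[OF w(1)] by force
  qed
  then show thesis using that by (auto simp: K_def)
qed

text \<open>Apply \<open>positive_combination\<close> to the normals together with their negatives:
  its hypothesis then concerns only nonzero \<open>w\<close> orthogonal to all of them, and there is
  none.\<close>

lemma linear_combination_of_separating:
  fixes n :: "'c::finite \<Rightarrow> 'a::euclidean_space"
  assumes "\<And>w. (\<And>c. c \<in> I \<Longrightarrow> n c \<bullet> w = 0) \<Longrightarrow> w = 0"
  obtains \<beta> :: "'c \<Rightarrow> real" where "v = (\<Sum>c\<in>I. \<beta> c *\<^sub>R n c)"
proof -
  define m where "m p = (if snd p then n (fst p) else - n (fst p))" for p :: "'c \<times> bool"
  obtain \<alpha> where \<alpha>: "v = (\<Sum>p\<in>I \<times> UNIV. \<alpha> p *\<^sub>R m p)"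
  proof (rule positive_combination[where n = m and I = "I \<times> UNIV" and v = v])
    fix w :: 'a assume "w \<noteq> 0" and w: "\<And>p. p \<in> I \<times> UNIV \<Longrightarrow> 0 \<le> m p \<bullet> w"
    have "n c \<bullet> w = 0" if "c \<in> I" for c
      using w[of "(c, True)"] w[of "(c, False)"] that by (simp add: m_def)
    then have "w = 0" by (rule assms)
    then show "0 < v \<bullet> w" using \<open>w \<noteq> 0\<close> by blast
  qed
  also have "(\<Sum>p\<in>I \<times> UNIV. \<alpha> p *\<^sub>R m p) = (\<Sum>c\<in>I. \<Sum>s\<in>UNIV. \<alpha> (c, s) *\<^sub>R m (c, s))"
    by (simp add: sum.cartesian_product)
  also have "\<dots> = (\<Sum>c\<in>I. (\<alpha> (c, True) - \<alpha> (c, False)) *\<^sub>R n c)"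
    by (simp add: UNIV_bool m_def algebra_simps)
  finally show thesis by (rule that)
qed

definition affine_poly :: "real \<Rightarrow> real^'v \<Rightarrow> 'v::finite rpoly" where
  "affine_poly b n = PConst b - (\<Sum>v\<in>UNIV. PConst (n $ v) * PVar v)"

lemma eval_affine_poly [simp]: "eval (affine_poly b n) (($) p) = b - n \<bullet> p"
  by (simp add: affine_poly_def inner_vec_def)

lemma sum_affine_poly:
  "(\<Sum>c\<in>I. PConst (\<alpha> c) * affine_poly (b c) (n c)) =
    affine_poly (\<Sum>c\<in>I. \<alpha> c * b c) (\<Sum>c\<in>I. \<alpha> c *\<^sub>R n c)"
proof -
  have "(\<Sum>c\<in>I. PConst (\<alpha> c) * affine_poly (b c) (n c)) = PConst (\<Sum>c\<in>I. \<alpha> c * b c) -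
      (\<Sum>c\<in>I. \<Sum>v\<in>UNIV. PConst (\<alpha> c * n c $ v) * PVar v)"
    by (simp add: affine_poly_def right_diff_distrib sum_subtractf sum_distrib_left PConst_sum PConst_mult mult.assoc)
  also have "(\<Sum>c\<in>I. \<Sum>v\<in>UNIV. PConst (\<alpha> c * n c $ v) * PVar v) =
      (\<Sum>v\<in>UNIV. PConst ((\<Sum>c\<in>I. \<alpha> c *\<^sub>R n c) $ v) * PVar v)"
    by (subst sum.swap) (simp add: PConst_sum sum_distrib_right)
  finally show ?thesis by (simp add: affine_poly_def)
qed

text \<open>Taylor expansion at a zero.\<close>

lemma affine_poly_vanishing:
  assumes "n \<bullet> p = b"
  shows "affine_poly b n = - (\<Sum>v\<in>UNIV. PConst (n $ v) * (PVar v - PConst (p $ v)))"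
proof -
  have "(\<Sum>v\<in>UNIV. PConst (n $ v) * (PVar v - PConst (p $ v))) =
      (\<Sum>v\<in>UNIV. PConst (n $ v) * PVar v) - PConst (n \<bullet> p)"
    by (simp add: right_diff_distrib sum_subtractf inner_vec_def PConst_sum PConst_mult)
  then show ?thesis using assms by (simp add: affine_poly_def)
qed

text \<open>A nonempty bounded polyhedron has no recession direction, so every vector is a strictly
  positive combination of the normals. The same combination of the constraints puts a constant minus
  the linear form into \<open>M\<close>; this is used for plus and minus each variable.\<close>

lemma archimedean_affine:
  fixes n :: "'c::finite \<Rightarrow> real^'v" and b :: "'c \<Rightarrow> real"
  defines "M \<equiv> quadratic_module (\<lambda>c. affine_poly (b c) (n c))"
  assumes bounded: "bounded {p. \<forall>c. n c \<bullet> p \<le> b c}" and ne: "{p. \<forall>c. n c \<bullet> p \<le> b c} \<noteq> {}"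
  shows "h \<in> order_span M 1"
proof (rule archimedean_if_variables_bounded)
  show M: "sos_cone M" unfolding M_def by (rule quadratic_module_cone)
  show "1 \<in> M" unfolding M_def by (intro sos_subset_quadratic_module one_in_sos)
  fix v :: 'v
  obtain p where p: "\<And>c. n c \<bullet> p \<le> b c" using ne by blast
  obtain R where R: "\<And>q. (\<And>c. n c \<bullet> q \<le> b c) \<Longrightarrow> norm q \<le> R"
    using bounded by (auto simp: bounded_iff)
  have no_dir: "w = 0" if w: "\<And>c. 0 \<le> n c \<bullet> w" for w
  proof (rule ccontr)
    assume "w \<noteq> 0"
    \<comment> \<open>Long enough to leave the ball of radius \<open>R\<close> when starting from
      \<open>p\<close>.\<close>
    define s where "s = (R + norm p + 1) / norm w"
    have "R \<ge> 0" using R[OF p] norm_ge_zero[of p] by linarith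
    then have s: "s \<ge> 0" by (simp add: s_def)
    have "n c \<bullet> (p - s *\<^sub>R w) \<le> b c" for c
      using p[of c] mult_nonneg_nonneg[OF s w[of c]] by (simp add: inner_diff_right)
    then have "norm (p - s *\<^sub>R w) \<le> R" by (rule R)
    moreover have "norm (s *\<^sub>R w) = R + norm p + 1"
      using \<open>R \<ge> 0\<close> \<open>w \<noteq> 0\<close> by (simp add: s_def)
    moreover have "norm (s *\<^sub>R w) \<le> norm (p - s *\<^sub>R w) + norm p"
      by (metis norm_minus_commute norm_triangle_sub add.commute)
    ultimately show False by linarith
  qed
  have bound: "\<exists>N. PConst N - (\<Sum>v\<in>UNIV. PConst (k $ v) * PVar v) \<in> M" for k
  proof -
    obtain \<alpha> where \<alpha>: "\<And>c. 0 < \<alpha> c" "k = (\<Sum>c\<in>UNIV. \<alpha> c *\<^sub>R n c)"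
      using positive_combination[where n = n and v = k and I = UNIV] no_dir by (metis UNIV_I)
    have "(\<Sum>c\<in>UNIV. PConst (\<alpha> c) * affine_poly (b c) (n c)) \<in> M"
      unfolding M_def
      by (intro sos_cone_sum sos_cone_scale quadratic_module_cone)
         (auto intro: generator_in_quadratic_module[of "\<lambda>c. affine_poly (b c) (n c)"] less_imp_le \<alpha>)
    then have "affine_poly (\<Sum>c\<in>UNIV. \<alpha> c * b c) k \<in> M"
      unfolding sum_affine_poly \<alpha>(2) .
    then show ?thesis unfolding affine_poly_def by blast
  qed
  have single: "(\<Sum>w\<in>UNIV. PConst (axis v s $ w) * PVar w) = PConst s * PVar v" for s
  proof -
    have "(\<Sum>w\<in>UNIV. PConst (axis v s $ w) * PVar w) = (\<Sum>w\<in>UNIV. if w = v then PConst s * PVar w else 0)"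
      by (intro sum.cong) (auto simp: axis_def)
    then show ?thesis by simp
  qed
  obtain N where N: "PConst N - PVar v \<in> M" using bound[of "axis v 1"] by (auto simp: single)
  obtain K where K: "PConst K + PVar v \<in> M"
    using bound[of "axis v (-1)"] by (auto simp: single PConst_minus)
  \<comment> \<open>\<open>order_span\<close> asks for one constant for both signs; the excess is a
    nonnegative constant, which lies in \<open>M\<close>.\<close>
  have c: "PConst (\<bar>N\<bar> + \<bar>K\<bar> - r) \<in> M" if "r \<in> {N, K}" for r
    unfolding M_def using that by (intro sos_subset_quadratic_module PConst_in_sos) auto
  have "PConst (\<bar>N\<bar> + \<bar>K\<bar>) * 1 - PVar v \<in> M" "PConst (\<bar>N\<bar> + \<bar>K\<bar>) * 1 + PVar v \<in> M"
    using sos_cone_add[OF M N c[of N]] sos_cone_add[OF M K c[of K]] by (simp_all add: PConst_diff add.commute)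
  then show "PVar v \<in> order_span M 1" unfolding order_span_def by blast
qed

section \<open>The bilinear problem over the two polyhedra\<close>

text \<open>Packs a pair into one vector indexed like the polynomial variables, so that the results
  on \<open>affine_poly\<close> treat both polyhedra at once.\<close>

definition pair_vec :: "real^'d \<Rightarrow> real^'d \<Rightarrow> real^('d::finite + 'd)" where
  "pair_vec x z = (\<chi> v. case v of Inl i \<Rightarrow> x $ i | Inr i \<Rightarrow> z $ i)"

lemma pair_vec_nth [simp]: "pair_vec x z $ Inl i = x $ i" "pair_vec x z $ Inr i = z $ i"
  by (simp_all add: pair_vec_def)

lemma sum_UNIV_Plus:
  fixes h :: "'a::finite + 'b::finite \<Rightarrow> 'c::comm_monoid_add"
  shows "(\<Sum>v\<in>UNIV. h v) = (\<Sum>i\<in>UNIV. h (Inl i)) + (\<Sum>i\<in>UNIV. h (Inr i))"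
  by (simp add: sum.Plus flip: UNIV_Plus_UNIV)

lemma inner_pair_vec [simp]: "pair_vec x z \<bullet> pair_vec x' z' = x \<bullet> x' + z \<bullet> z'"
  by (simp add: inner_vec_def sum_UNIV_Plus)

lemma pair_vec_exhaust: obtains x z where "p = pair_vec x z"
  by (rule that[of "\<chi> i. p $ Inl i" "\<chi> i. p $ Inr i"]) (auto simp: pair_vec_def vec_eq_iff split: sum.split)

lemma pair_vec_zero: "pair_vec 0 0 = 0"
  by (auto simp: pair_vec_def vec_eq_iff split: sum.split)

lemma pair_vec_diff_scale: "pair_vec x z - e *\<^sub>R pair_vec u v = pair_vec (x - e *\<^sub>R u) (z - e *\<^sub>R v)"
  by (auto simp: pair_vec_def vec_eq_iff split: sum.split)

definition constraint_bound :: "real^'k \<Rightarrow> 'k + 'l \<Rightarrow> real" where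
  "constraint_bound a c = (case c of Inl i \<Rightarrow> a $ i | Inr j \<Rightarrow> 1)"

definition constraint_normal :: "real^'d^'k \<Rightarrow> real^'l^'d \<Rightarrow> 'k + 'l \<Rightarrow> real^('d::finite + 'd)" where
  "constraint_normal A B c = (case c of Inl i \<Rightarrow> pair_vec (row i A) 0 | Inr j \<Rightarrow> pair_vec 0 (column j B))"

lemma constraint_eq_affine_poly:
  "constraint a A B c = affine_poly (constraint_bound a c) (constraint_normal A B c)"
  by (cases c)
     (simp_all add: constraint_def affine_poly_def constraint_bound_def constraint_normal_def
       sum_UNIV_Plus row_def column_def)

lemma H_polyhedron_iff: "x \<in> H_polyhedron a A \<longleftrightarrow> (\<forall>i. row i A \<bullet> x \<le> a $ i)"
  by (simp add: H_polyhedron_def less_eq_vec_def matrix_vector_mult_def row_def inner_vec_def)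

lemma polar_polyhedron_iff: "z \<in> polar_polyhedron B \<longleftrightarrow> (\<forall>j. column j B \<bullet> z \<le> 1)"
  by (simp add: polar_polyhedron_def less_eq_vec_def matrix_vector_mult_def column_def inner_vec_def transpose_def)

lemma constraints_iff:
  "(\<forall>c. constraint_normal A B c \<bullet> pair_vec x z \<le> constraint_bound a c) \<longleftrightarrow>
    x \<in> H_polyhedron a A \<and> z \<in> polar_polyhedron B"
  unfolding H_polyhedron_iff polar_polyhedron_iff
  by (auto simp: constraint_normal_def constraint_bound_def split_sum_all)

lemma polyhedron_H_polyhedron: "polyhedron (H_polyhedron a A)"
proof -
  have "H_polyhedron a A = \<Inter> ((\<lambda>i. {x. row i A \<bullet> x \<le> a $ i}) ` UNIV)"
    by (auto simp: H_polyhedron_iff)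
  also have "polyhedron \<dots>"
    by (rule polyhedron_Inter) (auto intro: polyhedron_halfspace_le)
  finally show ?thesis .
qed

lemma polyhedron_polar_polyhedron: "polyhedron (polar_polyhedron B)"
proof -
  have "polar_polyhedron B = \<Inter> ((\<lambda>j. {z. column j B \<bullet> z \<le> 1}) ` UNIV)"
    by (auto simp: polar_polyhedron_iff)
  also have "polyhedron \<dots>"
    by (rule polyhedron_Inter) (auto intro: polyhedron_halfspace_le)
  finally show ?thesis .
qed

section \<open>Polarity\<close>

lemma polar_polyhedron_inner_le:
  assumes "z \<in> polar_polyhedron B" "q \<in> V_polytope B"
  shows "q \<bullet> z \<le> 1"
proof -
  have "V_polytope B \<subseteq> {q. z \<bullet> q \<le> 1}"
    unfolding V_polytope_def
  proof (rule hull_minimal)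
    show "columns B \<subseteq> {q. z \<bullet> q \<le> 1}"
      using assms(1) by (auto simp: columns_def polar_polyhedron_iff inner_commute)
  qed (rule convex_halfspace_le)
  then show ?thesis using assms(2) by (auto simp: inner_commute)
qed

text \<open>The polytope contains a ball of radius \<open>e\<close> about 0; testing
  \<open>z\<close> against the point of norm \<open>e\<close> in its own direction gives
  \<open>norm z \<le> 1 / e\<close>.\<close>

lemma bounded_polar_polyhedron:
  assumes "0 \<in> interior (V_polytope B)"
  shows "bounded (polar_polyhedron B)"
proof -
  obtain e where e: "e > 0" "cball 0 e \<subseteq> V_polytope B"
    using assms by (meson mem_interior_cball)
  have "norm z \<le> 1 / e" if z: "z \<in> polar_polyhedron B" for z
  proof (cases "z = 0")
    case False
    have "(e / norm z) *\<^sub>R z \<in> V_polytope B"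
      using e False by (intro subsetD[OF e(2)]) auto
    from polar_polyhedron_inner_le[OF z this] have "e / norm z * (norm z)\<^sup>2 \<le> 1"
      by (simp add: power2_norm_eq_inner)
    then show ?thesis using e(1) False by (simp add: power2_eq_square field_simps)
  qed (use e in auto)
  then show ?thesis by (auto simp: bounded_iff)
qed

text \<open>The bipolar theorem. A hyperplane separating \<open>x\<close> from the polytope has
  offset \<open>b < 0\<close> because 0 lies in the polytope; its normal divided by \<open>b\<close>
  is a polar vector exceeding 1 on \<open>x\<close>.\<close>

lemma V_polytope_iff_polar:
  assumes "0 \<in> interior (V_polytope B)"
  shows "x \<in> V_polytope B \<longleftrightarrow> (\<forall>z\<in>polar_polyhedron B. x \<bullet> z \<le> 1)"
proof
  assume *: "\<forall>z\<in>polar_polyhedron B. x \<bullet> z \<le> 1"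
  show "x \<in> V_polytope B"
  proof (rule ccontr)
    assume "x \<notin> V_polytope B"
    moreover have "columns B = range (\<lambda>j. column j B)" by (auto simp: columns_def)
    then have "convex (V_polytope B)" "closed (V_polytope B)"
      unfolding V_polytope_def
      by (auto intro!: compact_imp_closed finite_imp_compact_convex_hull)
    ultimately obtain w b where wb: "w \<bullet> x < b" "\<And>q. q \<in> V_polytope B \<Longrightarrow> w \<bullet> q > b"
      using separating_hyperplane_closed_point by metis
    have b: "b < 0" using wb(2)[of 0] assms interior_subset by fastforce
    have "column j B \<bullet> ((1 / b) *\<^sub>R w) \<le> 1" for j
    proof -
      have "column j B \<in> V_polytope B" unfolding V_polytope_def by (rule hull_inc) (auto simp: columns_def)
      from wb(2)[OF this] b show ?thesis by (simp add: divide_simps inner_commute)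
    qed
    then have "(1 / b) *\<^sub>R w \<in> polar_polyhedron B" by (simp add: polar_polyhedron_iff)
    with * have "x \<bullet> ((1 / b) *\<^sub>R w) \<le> 1" by blast
    then show False using wb(1) b by (simp add: divide_simps inner_commute split: if_splits)
  qed
qed (use polar_polyhedron_inner_le in blast)

lemma eval_xTz [simp]: "eval xTz (($) (pair_vec x z)) = x \<bullet> z"
  by (simp add: xTz_def inner_vec_def)

lemma eval_constraint_nonneg_iff:
  "(\<forall>c. 0 \<le> eval (constraint a A B c) (($) (pair_vec x z))) \<longleftrightarrow>
    x \<in> H_polyhedron a A \<and> z \<in> polar_polyhedron B"
  by (simp add: constraint_eq_affine_poly flip: constraints_iff)

section \<open>Nonnegativity of module elements and truncation\<close>

lemma sos_eval_nonneg: "s \<in> sos \<Longrightarrow> 0 \<le> eval s y"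
  by (auto simp: sos_def sum_nonneg)

lemma quadratic_module_eval_nonneg:
  assumes "p \<in> quadratic_module g" "\<And>c. 0 \<le> eval (g c) y"
  shows "0 \<le> eval p y"
proof -
  obtain \<sigma>0 \<sigma> where "p = \<sigma>0 + (\<Sum>i\<in>UNIV. \<sigma> i * g i)" "\<sigma>0 \<in> sos" "\<And>i. \<sigma> i \<in> sos"
    using assms(1) by (auto simp: quadratic_module_def)
  then show ?thesis
    using assms(2) by (simp add: sos_eval_nonneg sum_nonneg)
qed

lemma truncated_subset: "truncated_quadratic_module t g \<subseteq> quadratic_module g"
  by (auto simp: truncated_quadratic_module_def quadratic_module_def)

text \<open>Finitely many degrees occur in a representation; their sum bounds each of them, at this
  and all later levels.\<close>

lemma quadratic_module_eventually_truncated: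
  assumes "p \<in> quadratic_module g"
  obtains t where "\<And>s. t \<le> s \<Longrightarrow> p \<in> truncated_quadratic_module s g"
proof -
  obtain \<sigma>0 \<sigma> where p: "p = \<sigma>0 + (\<Sum>i\<in>UNIV. \<sigma> i * g i)" "\<sigma>0 \<in> sos" "\<And>i. \<sigma> i \<in> sos"
    using assms by (auto simp: quadratic_module_def)
  define t where "t = total_degree \<sigma>0 + (\<Sum>i\<in>UNIV. total_degree (\<sigma> i * g i))"
  have 1: "total_degree (\<sigma> i * g i) \<le> t" for i
    unfolding t_def by (intro trans_le_add2 member_le_sum) auto
  have 2: "total_degree \<sigma>0 \<le> t" by (simp add: t_def)
  have "total_degree \<sigma>0 \<le> 2 * s" "total_degree (\<sigma> i * g i) \<le> 2 * s" if "t \<le> s" for s i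
    using 1[of i] 2 that by linarith+
  then have "p \<in> truncated_quadratic_module s g" if "t \<le> s" for s
    unfolding truncated_quadratic_module_def using p that by blast
  then show thesis by (rule that)
qed

lemma zero_in_polar_polyhedron: "0 \<in> polar_polyhedron B"
  by (simp add: polar_polyhedron_iff)

section \<open>Optimal pairs and the segments between them\<close>

lemma optimal_iff:
  "(x, z) \<in> optimal_solutions a A B \<longleftrightarrow>
    x \<in> H_polyhedron a A \<and> z \<in> polar_polyhedron B \<and> x \<bullet> z = mu_star a A B"
  by (auto simp: optimal_solutions_def)

lemma convex_H_polyhedron: "convex (H_polyhedron a A)"
  and convex_polar_polyhedron: "convex (polar_polyhedron B)"
  by (simp_all add: polyhedron_imp_convex polyhedron_H_polyhedron polyhedron_polar_polyhedron)

text \<open>For fixed \<open>z\<close> the objective is affine in \<open>x\<close>, hence constant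
  on a segment with optimal ends.\<close>

lemma optimal_segment_left:
  assumes "(x, z) \<in> optimal_solutions a A B" "(x', z) \<in> optimal_solutions a A B" "w \<in> closed_segment x x'"
  shows "(w, z) \<in> optimal_solutions a A B"
proof -
  obtain t where w: "w = (1 - t) *\<^sub>R x + t *\<^sub>R x'" using assms(3) by (auto simp: in_segment)
  have "w \<in> H_polyhedron a A"
    using assms closed_segment_subset[OF _ _ convex_H_polyhedron, of x a A x'] by (auto simp: optimal_iff)
  moreover have "w \<bullet> z = mu_star a A B"
    using assms by (simp add: w optimal_iff inner_add_left algebra_simps)
  ultimately show ?thesis using assms by (simp add: optimal_iff)
qed

lemma optimal_segment_right:
  assumes "(x, z) \<in> optimal_solutions a A B" "(x, z') \<in> optimal_solutions a A B" "w \<in> closed_segment z z'"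
  shows "(x, w) \<in> optimal_solutions a A B"
proof -
  obtain t where w: "w = (1 - t) *\<^sub>R z + t *\<^sub>R z'" using assms(3) by (auto simp: in_segment)
  have "w \<in> polar_polyhedron B"
    using assms closed_segment_subset[OF _ _ convex_polar_polyhedron, of z B z'] by (auto simp: optimal_iff)
  moreover have "x \<bullet> w = mu_star a A B"
    using assms by (simp add: w optimal_iff inner_add_right algebra_simps)
  ultimately show ?thesis using assms by (simp add: optimal_iff)
qed

text \<open>A second maximiser would make a whole segment optimal, giving infinitely many optimal
  pairs.\<close>

lemma optimal_unique_left:
  assumes "finite (optimal_solutions a A B)"
    and "(x, z) \<in> optimal_solutions a A B" "(x', z) \<in> optimal_solutions a A B"
  shows "x = x'"
proof (rule ccontr)
  assume "x \<noteq> x'"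
  then have "infinite (closed_segment x x')"
    using uncountable_closed_segment countable_finite by blast
  moreover have "closed_segment x x' \<subseteq> fst ` optimal_solutions a A B"
    using optimal_segment_left[OF assms(2,3)] by force
  ultimately show False using assms(1) finite_subset by blast
qed

lemma optimal_unique_right:
  assumes "finite (optimal_solutions a A B)"
    and "(x, z) \<in> optimal_solutions a A B" "(x, z') \<in> optimal_solutions a A B"
  shows "z = z'"
proof (rule ccontr)
  assume "z \<noteq> z'"
  then have "infinite (closed_segment z z')"
    using uncountable_closed_segment countable_finite by blast
  moreover have "closed_segment z z' \<subseteq> snd ` optimal_solutions a A B"
    using optimal_segment_right[OF assms(2,3)] by force
  ultimately show False using assms(1) finite_subset by blast
qed

section \<open>Attainment, vertex pairs and the certificate\<close>

context
  fixes a :: "real^'k" and A :: "real^'d^'k" and B :: "real^'l^'d"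
  assumes polyP: "polytope (H_polyhedron a A)" and neP: "H_polyhedron a A \<noteq> {}"
    and intQ: "0 \<in> interior (V_polytope B)"
begin

lemma compact_feasible: "compact (H_polyhedron a A \<times> polar_polyhedron B)"
  by (intro compact_Times polytope_imp_compact[OF polyP])
     (simp add: compact_eq_bounded_closed bounded_polar_polyhedron[OF intQ] polyhedron_imp_closed polyhedron_polar_polyhedron)

text \<open>Compactness makes the supremum a maximum, so \<open>mu_star\<close> is an attained value
  and not an unspecified real supremum.\<close>

lemma optimum_exists: "\<exists>x z. (x, z) \<in> optimal_solutions a A B"
  and inner_le_mu_star: "x \<in> H_polyhedron a A \<Longrightarrow> z \<in> polar_polyhedron B \<Longrightarrow> x \<bullet> z \<le> mu_star a A B"
proof -
  have cont: "continuous_on (H_polyhedron a A \<times> polar_polyhedron B) (\<lambda>p. fst p \<bullet> snd p)"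
    by (intro continuous_intros)
  have ne: "H_polyhedron a A \<times> polar_polyhedron B \<noteq> {}" using neP zero_in_polar_polyhedron by blast
  obtain p where p: "p \<in> H_polyhedron a A \<times> polar_polyhedron B"
    and max: "\<And>q. q \<in> H_polyhedron a A \<times> polar_polyhedron B \<Longrightarrow> fst q \<bullet> snd q \<le> fst p \<bullet> snd p"
    using continuous_attains_sup[OF compact_feasible ne cont] by blast
  have mu: "mu_star a A B = fst p \<bullet> snd p"
    unfolding mu_star_def
  proof (rule cSup_eq_maximum)
    show "fst p \<bullet> snd p \<in> (\<lambda>(x, z). x \<bullet> z) ` (H_polyhedron a A \<times> polar_polyhedron B)"
      by (rule image_eqI[OF _ p]) (simp add: case_prod_beta)
    fix y assume "y \<in> (\<lambda>(x, z). x \<bullet> z) ` (H_polyhedron a A \<times> polar_polyhedron B)"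
    then obtain q where "q \<in> H_polyhedron a A \<times> polar_polyhedron B" "y = fst q \<bullet> snd q"
      by (auto simp: case_prod_beta)
    then show "y \<le> fst p \<bullet> snd p" using max by simp
  qed
  show "\<exists>x z. (x, z) \<in> optimal_solutions a A B"
    using p mu by (intro exI[of _ "fst p"] exI[of _ "snd p"]) (auto simp: optimal_solutions_def)
  show "x \<bullet> z \<le> mu_star a A B" if "x \<in> H_polyhedron a A" "z \<in> polar_polyhedron B"
    using max[of "(x, z)"] that mu by simp
qed

text \<open>Polyhedra have finitely many extreme points. Conversely, if an optimal \<open>x\<close>
  were inside a segment, both ends would be optimal for the same \<open>z\<close>, as an average
  attains its upper bound only if both values do; this contradicts uniqueness. The same holds for
  \<open>z\<close>.\<close>

lemma vertex_pairs_iff_finite: "optima_are_vertex_pairs a A B \<longleftrightarrow> finite (optimal_solutions a A B)"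
proof
  assume "optima_are_vertex_pairs a A B"
  then have "optimal_solutions a A B \<subseteq>
      {x. x extreme_point_of H_polyhedron a A} \<times> {z. z extreme_point_of polar_polyhedron B}"
    by (auto simp: optima_are_vertex_pairs_def)
  then show "finite (optimal_solutions a A B)"
    by (rule finite_subset)
       (intro finite_cartesian_product finite_polyhedron_extreme_points polyhedron_H_polyhedron polyhedron_polar_polyhedron)
next
  assume fin: "finite (optimal_solutions a A B)"
  have convex_max: "r = m \<and> s = m" if "(1 - t) * r + t * s = m" "r \<le> m" "s \<le> m" "0 < t" "t < 1" for r s t m :: real
  proof -
    have "(1 - t) * (m - r) + t * (m - s) = 0" using that(1) by (simp add: algebra_simps)
    moreover have "0 \<le> (1 - t) * (m - r)" "0 \<le> t * (m - s)" using that by auto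
    ultimately show ?thesis using that by (simp add: add_nonneg_eq_0_iff)
  qed
  show "optima_are_vertex_pairs a A B"
    unfolding optima_are_vertex_pairs_def
  proof safe
    fix x z assume opt: "(x, z) \<in> optimal_solutions a A B"
    then have x: "x \<in> H_polyhedron a A" and z: "z \<in> polar_polyhedron B" and xz: "x \<bullet> z = mu_star a A B"
      by (auto simp: optimal_iff)
    show "x extreme_point_of H_polyhedron a A"
      unfolding extreme_point_of_def
    proof (intro conjI ballI x notI)
      fix p q assume pq: "p \<in> H_polyhedron a A" "q \<in> H_polyhedron a A" "x \<in> open_segment p q"
      then obtain t where t: "p \<noteq> q" "0 < t" "t < 1" "x = (1 - t) *\<^sub>R p + t *\<^sub>R q"
        by (auto simp: in_segment)
      have "(1 - t) * (p \<bullet> z) + t * (q \<bullet> z) = mu_star a A B"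
        using xz by (simp add: t(4) inner_add_left)
      from convex_max[OF this _ _ t(2,3)] inner_le_mu_star pq z
      have "(p, z) \<in> optimal_solutions a A B" "(q, z) \<in> optimal_solutions a A B" by (auto simp: optimal_iff)
      then show False using optimal_unique_left[OF fin] t(1) by blast
    qed
    show "z extreme_point_of polar_polyhedron B"
      unfolding extreme_point_of_def
    proof (intro conjI ballI z notI)
      fix p q assume pq: "p \<in> polar_polyhedron B" "q \<in> polar_polyhedron B" "z \<in> open_segment p q"
      then obtain t where t: "p \<noteq> q" "0 < t" "t < 1" "z = (1 - t) *\<^sub>R p + t *\<^sub>R q"
        by (auto simp: in_segment)
      have "(1 - t) * (x \<bullet> p) + t * (x \<bullet> q) = mu_star a A B"
        using xz by (simp add: t(4) inner_add_right)
      from convex_max[OF this _ _ t(2,3)] inner_le_mu_star pq x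
      have "(x, p) \<in> optimal_solutions a A B" "(x, q) \<in> optimal_solutions a A B" by (auto simp: optimal_iff)
      then show False using optimal_unique_right[OF fin] t(1) by blast
    qed
  qed
qed

text \<open>Strict complementarity: moving from an optimal pair \<open>(x, z)\<close> against \<open>(u, v)\<close> stays feasible for
  a short time, and by uniqueness of the partial maximisers the linearised objective strictly drops.\<close>

lemma optimal_strict_normal:
  assumes fin: "finite (optimal_solutions a A B)" and opt: "(x, z) \<in> optimal_solutions a A B"
    and "w \<noteq> 0"
    and w: "\<And>c. constraint_normal A B c \<bullet> pair_vec x z = constraint_bound a c \<Longrightarrow> 0 \<le> constraint_normal A B c \<bullet> w"
  shows "0 < pair_vec z x \<bullet> w"
proof -
  let ?n = "constraint_normal A B" and ?b = "constraint_bound a" and ?p = "pair_vec x z"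
  have xz: "x \<in> H_polyhedron a A" "z \<in> polar_polyhedron B" "x \<bullet> z = mu_star a A B"
    using opt by (auto simp: optimal_iff)
  have feas: "?n c \<bullet> ?p \<le> ?b c" for c
    using constraints_iff[of A B x z a] xz by blast
  have "\<forall>\<^sub>F e in at_right (0::real). ?n c \<bullet> (?p - e *\<^sub>R w) \<le> ?b c" for c
  proof (cases "?n c \<bullet> ?p = ?b c")
    case True
    from w[OF True] have "?n c \<bullet> (?p - e *\<^sub>R w) \<le> ?b c" if "e > 0" for e
      using True that by (simp add: inner_diff_right)
    then show ?thesis by (auto simp: eventually_at_right_less intro: eventually_mono[OF eventually_at_right_less])
  next
    case False
    then have "?n c \<bullet> ?p < ?b c" using feas[of c] by simp
    moreover have "((\<lambda>e. ?n c \<bullet> (?p - e *\<^sub>R w)) \<longlongrightarrow> ?n c \<bullet> (?p - 0 *\<^sub>R w)) (at_right 0)"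
      by (intro tendsto_intros)
    ultimately have "\<forall>\<^sub>F e in at_right 0. ?n c \<bullet> (?p - e *\<^sub>R w) < ?b c"
      by (intro order_tendstoD) auto
    then show ?thesis by (auto elim: eventually_mono)
  qed
  then have "\<forall>\<^sub>F e in at_right (0::real). \<forall>c. ?n c \<bullet> (?p - e *\<^sub>R w) \<le> ?b c"
    by (simp add: eventually_all_finite)
  then have "\<forall>\<^sub>F e in at_right (0::real). (\<forall>c. ?n c \<bullet> (?p - e *\<^sub>R w) \<le> ?b c) \<and> e > 0"
    using eventually_at_right_less by (intro eventually_conj)
  then obtain e :: real where e: "e > 0" and ef: "\<And>c. ?n c \<bullet> (?p - e *\<^sub>R w) \<le> ?b c"
    using eventually_happens'[OF trivial_limit_at_right_real] by blast
  obtain u v where uv: "w = pair_vec u v" by (rule pair_vec_exhaust)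
  have new: "x - e *\<^sub>R u \<in> H_polyhedron a A" "z - e *\<^sub>R v \<in> polar_polyhedron B"
    using ef constraints_iff[of A B "x - e *\<^sub>R u" "z - e *\<^sub>R v" a] by (auto simp: uv pair_vec_diff_scale)
  \<comment> \<open>The constraints do not couple \<open>x\<close> and \<open>z\<close>, so each
    half may be moved alone; this avoids the term quadratic in \<open>e\<close>.\<close>
  have 1: "0 \<le> z \<bullet> u" "0 \<le> x \<bullet> v"
    using inner_le_mu_star[OF new(1) xz(2)] inner_le_mu_star[OF xz(1) new(2)] xz(3) e
    by (auto simp: inner_diff_left inner_diff_right inner_commute zero_le_mult_iff)
  have 2: "u = 0" if "z \<bullet> u = 0"
  proof -
    have "(x - e *\<^sub>R u, z) \<in> optimal_solutions a A B"
      using new xz that by (simp add: optimal_iff inner_diff_left inner_commute[of u z])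
    from optimal_unique_left[OF fin opt this] e show ?thesis by simp
  qed
  have 3: "v = 0" if "x \<bullet> v = 0"
  proof -
    have "(x, z - e *\<^sub>R v) \<in> optimal_solutions a A B"
      using new xz that by (simp add: optimal_iff inner_diff_right)
    from optimal_unique_right[OF fin opt this] e show ?thesis by simp
  qed
  have "u \<noteq> 0 \<or> v \<noteq> 0" using \<open>w \<noteq> 0\<close> uv pair_vec_zero by auto
  then have "z \<bullet> u \<noteq> 0 \<or> x \<bullet> v \<noteq> 0" using 2 3 by blast
  then have "0 < z \<bullet> u + x \<bullet> v" using 1 by linarith
  then show ?thesis by (simp add: uv)
qed

text \<open>Checks the criterion for finitely many linear zeros with the optimal pairs as
  \<open>Z\<close>. Both local conditions come from \<open>optimal_strict_normal\<close>: it makes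
  the active normals span, and it makes the coefficients of the gradient strictly positive.\<close>

lemma certificate_exists:
  assumes fin: "finite (optimal_solutions a A B)"
  shows "PConst (mu_star a A B) - xTz \<in> QM a A B"
proof -
  let ?n = "constraint_normal A B" and ?b = "constraint_bound a"
  let ?pt = "\<lambda>(x, z). ($) (pair_vec x z) :: 'd + 'd \<Rightarrow> real"
  let ?f = "PConst (mu_star a A B) - xTz"
  define g where "g c = affine_poly (?b c) (?n c)" for c
  define act where "act p = {c. ?n c \<bullet> p = ?b c}" for p
  have g: "constraint a A B = g" by (simp add: fun_eq_iff g_def constraint_eq_affine_poly)
  have act: "{c. eval (g c) (($) p) = 0} = act p" for p by (auto simp: g_def act_def)
  have comb: "(\<Sum>c\<in>act p. PConst (\<alpha> c) * g c) =
      - (\<Sum>v\<in>UNIV. PConst ((\<Sum>c\<in>act p. \<alpha> c *\<^sub>R ?n c) $ v) * (PVar v - PConst (p $ v)))" for p \<alpha>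
    unfolding g_def sum_affine_poly
    by (rule affine_poly_vanishing) (auto simp: inner_sum_left act_def intro!: sum.cong)
  have "?f \<in> quadratic_module g"
  proof (rule quadratic_module_member_if_linear_zeros[where Z = "?pt ` optimal_solutions a A B"])
    have feas: "{p. \<forall>c. ?n c \<bullet> p \<le> ?b c} = (\<lambda>(x, z). pair_vec x z) ` (H_polyhedron a A \<times> polar_polyhedron B)"
    proof (intro equalityI subsetI)
      fix p assume p: "p \<in> {p. \<forall>c. ?n c \<bullet> p \<le> ?b c}"
      obtain x z where "p = pair_vec x z" by (rule pair_vec_exhaust)
      then show "p \<in> (\<lambda>(x, z). pair_vec x z) ` (H_polyhedron a A \<times> polar_polyhedron B)"
        using p constraints_iff[of A B x z a] by auto
    next
      fix p assume "p \<in> (\<lambda>(x, z). pair_vec x z) ` (H_polyhedron a A \<times> polar_polyhedron B)"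
      then obtain x z where "p = pair_vec x z" "x \<in> H_polyhedron a A" "z \<in> polar_polyhedron B" by auto
      then show "p \<in> {p. \<forall>c. ?n c \<bullet> p \<le> ?b c}"
        using constraints_iff[of A B x z a] by simp
    qed
    have norm: "norm (pair_vec x z) = norm (x, z)" for x z :: "real^'d"
      by (simp add: norm_eq_sqrt_inner)
    have "bounded {p. \<forall>c. ?n c \<bullet> p \<le> ?b c}"
      using compact_imp_bounded[OF compact_feasible]
      unfolding feas bounded_iff by (auto simp: norm)
    moreover have "{p. \<forall>c. ?n c \<bullet> p \<le> ?b c} \<noteq> {}"
      unfolding feas using neP zero_in_polar_polyhedron by blast
    ultimately show "h \<in> order_span (quadratic_module g) 1" for h
      unfolding g_def by (rule archimedean_affine)
    show "finite (?pt ` optimal_solutions a A B)" using fin by blast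
    show "?pt ` optimal_solutions a A B \<noteq> {}" using optimum_exists by blast
  next
    fix y assume y: "\<And>c. 0 \<le> eval (g c) y" "y \<notin> ?pt ` optimal_solutions a A B"
    obtain x z where "(\<chi> v. y v) = pair_vec x z" by (rule pair_vec_exhaust)
    then have yp: "y = ($) (pair_vec x z)" by (simp add: fun_eq_iff vec_eq_iff)
    then have xz: "x \<in> H_polyhedron a A" "z \<in> polar_polyhedron B"
      using y(1) eval_constraint_nonneg_iff[of a A B x z] by (auto simp: g)
    moreover have "(x, z) \<notin> optimal_solutions a A B" using y(2) yp by (force simp: image_iff)
    ultimately have "x \<bullet> z < mu_star a A B"
      using inner_le_mu_star[OF xz] by (auto simp: optimal_iff)
    then show "0 < eval ?f y" by (simp add: yp)
  next
    fix y v assume "y \<in> ?pt ` optimal_solutions a A B"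
    then obtain x z where opt: "(x, z) \<in> optimal_solutions a A B" and y: "y = ($) (pair_vec x z)" by auto
    let ?p = "pair_vec x z"
    note strict = optimal_strict_normal[OF fin opt]
    \<comment> \<open>A nonzero \<open>w\<close> orthogonal to all active normals could be used with
      either sign, making \<open>pair_vec z x \<bullet> w\<close> and its negative both
      positive.\<close>
    have sep: "w = 0" if "\<And>c. c \<in> act ?p \<Longrightarrow> ?n c \<bullet> w = 0" for w
    proof (rule ccontr)
      assume "w \<noteq> 0"
      have "0 < pair_vec z x \<bullet> w"
        using that by (intro strict[OF \<open>w \<noteq> 0\<close>]) (simp add: act_def)
      moreover have "0 < pair_vec z x \<bullet> (- w)"
        using that \<open>w \<noteq> 0\<close> by (intro strict) (simp_all add: act_def)
      ultimately show False by simp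
    qed
    obtain \<beta> where \<beta>: "axis v 1 = (\<Sum>c\<in>act ?p. \<beta> c *\<^sub>R ?n c)"
      using linear_combination_of_separating[of "act ?p" ?n "axis v 1"] sep by blast
    \<comment> \<open>The linear part of \<open>g c\<close> is minus its normal, hence the
      coefficients \<open>- \<beta> c\<close>.\<close>
    have "(\<Sum>c\<in>act ?p. PConst (- \<beta> c) * g c) = - (\<Sum>c\<in>act ?p. PConst (\<beta> c) * g c)"
      by (simp add: PConst_minus sum_negf)
    also have "\<dots> = (\<Sum>w\<in>UNIV. PConst (axis v 1 $ w) * (PVar w - PConst (?p $ w)))"
      unfolding comb \<beta> by simp
    also have "\<dots> = (\<Sum>w\<in>UNIV. if w = v then PVar w - PConst (?p $ w) else 0)"
      by (intro sum.cong) (auto simp: axis_def)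
    finally show "\<exists>\<beta>. PVar v - PConst (y v) = (\<Sum>c | eval (g c) y = 0. PConst (\<beta> c) * g c)"
      unfolding y act by (intro exI[of _ "\<lambda>c. - \<beta> c"]) simp
  next
    fix y assume "y \<in> ?pt ` optimal_solutions a A B"
    then obtain x z where opt: "(x, z) \<in> optimal_solutions a A B" and y: "y = ($) (pair_vec x z)" by auto
    let ?p = "pair_vec x z"
    obtain \<alpha> where \<alpha>: "\<And>c. 0 < \<alpha> c" "pair_vec z x = (\<Sum>c\<in>act ?p. \<alpha> c *\<^sub>R ?n c)"
      using positive_combination[of "act ?p" ?n "pair_vec z x"]
        optimal_strict_normal[OF fin opt] by (auto simp: act_def)
    \<comment> \<open>At an optimal pair the second order part of \<open>?f\<close> is minus the sum
      of the products of the shifted \<open>x\<close> and \<open>z\<close> variables; all of it is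
      booked under the \<open>x\<close> variables.\<close>
    define q where "q v = (case v of Inl i \<Rightarrow> - (PZ i - PConst (z $ i)) | Inr i \<Rightarrow> 0)" for v :: "'d + 'd"
    have mu: "mu_star a A B = (\<Sum>i\<in>UNIV. x $ i * z $ i)"
      using opt by (simp add: optimal_iff inner_vec_def)
    have "?f = (\<Sum>c\<in>act ?p. PConst (\<alpha> c) * g c) + (\<Sum>v\<in>UNIV. (PVar v - PConst (?p $ v)) * q v)"
      unfolding comb \<alpha>(2)[symmetric]
      by (simp add: mu xTz_def sum_UNIV_Plus q_def PConst_sum PConst_mult algebra_simps sum.distrib sum_subtractf sum_negf)
    moreover have "eval (q v) (($) ?p) = 0" for v by (simp add: q_def split: sum.split)
    ultimately show "\<exists>\<alpha> q. (\<forall>c. 0 < \<alpha> c) \<and> (\<forall>v. eval (q v) y = 0) \<and>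
        ?f = (\<Sum>c | eval (g c) y = 0. PConst (\<alpha> c) * g c) + (\<Sum>v\<in>UNIV. (PVar v - PConst (y v)) * q v)"
      unfolding y act using \<alpha>(1) by blast
  qed
  then show ?thesis by (simp add: QM_def g)
qed

text \<open>Soundness at every level: a certificate is nonnegative on the feasible set, in
  particular at an optimal pair.\<close>

lemma mu_star_le_mu_level: "ereal (mu_star a A B) \<le> mu_level a A B t"
  unfolding mu_level_def
proof (rule Inf_greatest, safe)
  fix \<mu> assume "PConst \<mu> - xTz \<in> QM_trunc t a A B"
  then have *: "PConst \<mu> - xTz \<in> quadratic_module (constraint a A B)"
    using truncated_subset by (auto simp: QM_trunc_def)
  obtain x z where xz: "(x, z) \<in> optimal_solutions a A B"
    using optimum_exists by blast
  have "0 \<le> eval (PConst \<mu> - xTz) (($) (pair_vec x z))"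
    by (rule quadratic_module_eval_nonneg[OF *])
       (use xz eval_constraint_nonneg_iff[of a A B x z] in \<open>auto simp: optimal_iff\<close>)
  then show "ereal (mu_star a A B) \<le> ereal \<mu>"
    using xz by (simp add: optimal_iff)
qed

text \<open>By polarity, containment says that the objective is at most 1 on all feasible pairs, and
  its maximum is \<open>mu_star\<close>.\<close>

lemma contained_iff_mu_star_le_1: "H_polyhedron a A \<subseteq> V_polytope B \<longleftrightarrow> mu_star a A B \<le> 1"
proof
  obtain x z where "(x, z) \<in> optimal_solutions a A B"
    using optimum_exists by blast
  then have xz: "x \<in> H_polyhedron a A" "z \<in> polar_polyhedron B" "x \<bullet> z = mu_star a A B"
    by (auto simp: optimal_iff)
  assume "H_polyhedron a A \<subseteq> V_polytope B"
  then have "x \<bullet> z \<le> 1" using polar_polyhedron_inner_le[OF xz(2)] xz(1) by blast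
  then show "mu_star a A B \<le> 1" using xz(3) by simp
next
  assume "mu_star a A B \<le> 1"
  then show "H_polyhedron a A \<subseteq> V_polytope B"
    using inner_le_mu_star V_polytope_iff_polar[OF intQ] by fastforce
qed

end

theorem theorem4p4:
  fixes a :: "real^'k" and A :: "real^'d^'k" and B :: "real^'l^'d"
  assumes "polytope (H_polyhedron a A)"
    and "interior (H_polyhedron a A) \<noteq> {}"
    and "0 \<in> interior (V_polytope B)"
  shows "(optima_are_vertex_pairs a A B \<longleftrightarrow> finite (optimal_solutions a A B)) \<and>
    (optima_are_vertex_pairs a A B \<longrightarrow>
      PConst (mu_star a A B) - xTz \<in> QM a A B \<and>
      (\<exists>t\<ge>2. mu_level a A B t = ereal (mu_star a A B) \<and>
         (\<forall>s\<ge>t. H_polyhedron a A \<subseteq> V_polytope B \<longleftrightarrow> mu_level a A B s \<le> 1)))"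
proof -
  have ne: "H_polyhedron a A \<noteq> {}" using assms(2) interior_subset by blast
  note iff = vertex_pairs_iff_finite[OF assms(1) ne assms(3)]
  have "PConst (mu_star a A B) - xTz \<in> QM a A B \<and>
      (\<exists>t\<ge>2. mu_level a A B t = ereal (mu_star a A B) \<and>
         (\<forall>s\<ge>t. H_polyhedron a A \<subseteq> V_polytope B \<longleftrightarrow> mu_level a A B s \<le> 1))"
    if "optima_are_vertex_pairs a A B"
  proof -
    have cert: "PConst (mu_star a A B) - xTz \<in> QM a A B"
      using certificate_exists[OF assms(1) ne assms(3)] that iff by blast
    obtain t where t: "\<And>s. t \<le> s \<Longrightarrow> PConst (mu_star a A B) - xTz \<in> QM_trunc s a A B"
      using quadratic_module_eventually_truncated[OF cert[unfolded QM_def]]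
      unfolding QM_trunc_def by blast
    have eq: "mu_level a A B s = ereal (mu_star a A B)" if "t \<le> s" for s
    proof (rule antisym[OF _ mu_star_le_mu_level[OF assms(1) ne assms(3)]])
      show "mu_level a A B s \<le> ereal (mu_star a A B)"
        unfolding mu_level_def using t[OF that] by (intro Inf_lower) blast
    qed
    \<comment> \<open>The maximum with 2 meets the required \<open>t \<ge> 2\<close>; since
      \<open>eq\<close> holds at every level from \<open>t\<close> on, each such level decides
      containment.\<close>
    show ?thesis
      using cert eq contained_iff_mu_star_le_1[OF assms(1) ne assms(3)]
      by (intro conjI exI[of _ "max 2 t"]) auto
  qed
  then show ?thesis using iff by blast
qed

end
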